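(* Let $\mathrm T\subseteq\Omega$ be a set of test truth values with associated sets $\Sigma$ of open and $\mathrm Z$ of closed truth values. The following statements are equivalent. (1) $\Sigma$ is a dominance for $\mathrm T$. (2) Strongly open subsets are classified by $\overline\Sigma$, i.e. for every set $X$ a subset $U\subseteq X$ is strongly open in $X$ if and only if the truth value of $x\in U$ is in $\overline\Sigma$ for all $x\in X$. (3) Strongly open subsets are classified by some subset of $\Omega$. (4) All maps are continuous with regard to strongly open subsets, i.e. for every map $f\colon X\to Y$ and every strongly open $V\subseteq Y$ the preimage $f^{-1}(V)$ is strongly open in $X$. Analogously, the following statements are equivalent. (1') $\mathrm Z$ is a codominance for $\mathrm T$. (2') Strongly closed subsets are classified by $\overline{\mathrm Z}$. (3') Strongly closed subsets are classified by some subset of $\Omega$. (4') All maps are continuous with regard to strongly closed subsets (preimages of strongly closed subsets are strongly closed).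
   Context: Setting: intuitionistic higher-order logic (internal logic of an elementary topos), without excluded middle or choice. $\Omega$ is the set of truth values. Statements quantifying over all sets or maps are understood schematically. Given an arbitrary $\mathrm T\subseteq\Omega$ (test truth values), define $\Sigma=\{u\in\Omega\mid \forall t\in\mathrm T.\ (u\land t)\in\mathrm T\}$ (open truth values) and $\mathrm Z=\{f\in\Omega\mid\forall t\in\mathrm T.\ (f\Rightarrow t)\in\mathrm T\}$ (closed truth values). A subset $A\subseteq X$ is test/open/closed in $X$ if for every $x\in X$ the truth value of $x\in A$ is in $\mathrm T$/$\Sigma$/$\mathrm Z$. In general, a class of subsets is classified by $S\subseteq\Omega$ if $A\subseteq X$ belongs to the class exactly when $(x\in A)\in S$ for all $x\in X$. A subset $A\subseteq X$ is a subspace of $X$ if for every test subset $B$ of $A$ there is a test subset $C$ of $X$ with $B=A\cap C$. An open (closed) subset which is a subspace is called strongly open (strongly closed). Identifying truth values with subsets of a singleton $\mathbf 1$, $\overline\Sigma$ (resp. $\overline{\mathrm Z}$) is the set of truth values corresponding to strongly open (resp. strongly closed) subsets of $\mathbf 1$. $\Sigma$ is a dominance for $\mathrm T$ if $\forall u\in\Sigma\,\forall p\in\Omega.\ (u\Rightarrow(p\in\mathrm T))\Rightarrow (u\land p)\in\mathrm T$. $\mathrm Z$ is a codominance for $\mathrm T$ if $\forall f\in\mathrm Z\,\forall p\in\Omega.\ (f\Rightarrow(p\in\mathrm T))\Rightarrow (f\Rightarrow p)\in\mathrm T$. *)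

theory Defs
  imports Main
begin

text \<open>
  HOL itself is classical, so the statement is about a deeply embedded object logic: intuitionistic
  higher-order logic, the type theory of Lambek and Scott that is interpreted in elementary toposes.
  A signature consists of a HOL type of base types and of constants with their types
  (\<open>sg :: 'c \<Rightarrow> 'b ty\<close>); taking the objects of a topos as base types and the graphs of its morphisms
  as constants gives its internal language.
\<close>

section \<open>Intuitionistic higher-order logic\<close>

datatype 'b ty = Base 'b | One | Omega | Prod "'b ty" "'b ty" | Power "'b ty"

text \<open>
  Variables are de Bruijn indices. \<open>Compr A \<phi>\<close> is $\{x : A \mid \phi\}$; it and the quantifiers bind
  index 0. Formulas are the terms of type \<open>Omega\<close>.
\<close>

datatype ('b, 'c) tm =
    Var nat
  | Cst 'c
  | Star
  | Pr "('b, 'c) tm" "('b, 'c) tm"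
  | Fst "('b, 'c) tm"
  | Snd "('b, 'c) tm"
  | Compr "'b ty" "('b, 'c) tm"
  | In "('b, 'c) tm" "('b, 'c) tm"  (infix "\<^bold>\<in>" 55)
  | Equ "('b, 'c) tm" "('b, 'c) tm"  (infix "\<^bold>=" 50)
  | Tru  ("\<^bold>\<top>")
  | Fls  ("\<^bold>\<bottom>")
  | Conj "('b, 'c) tm" "('b, 'c) tm"  (infixr "\<^bold>\<and>" 45)
  | Disj "('b, 'c) tm" "('b, 'c) tm"  (infixr "\<^bold>\<or>" 40)
  | Impl "('b, 'c) tm" "('b, 'c) tm"  (infixr "\<^bold>\<longrightarrow>" 35)
  | Forall "'b ty" "('b, 'c) tm"  ("\<^bold>\<forall>[_]. _" [0, 30] 30)
  | Exist "'b ty" "('b, 'c) tm"  ("\<^bold>\<exists>[_]. _" [0, 30] 30)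

abbreviation Iff :: "('b, 'c) tm \<Rightarrow> ('b, 'c) tm \<Rightarrow> ('b, 'c) tm"  (infix "\<^bold>\<longleftrightarrow>" 33) where
  "\<phi> \<^bold>\<longleftrightarrow> \<psi> \<equiv> (\<phi> \<^bold>\<longrightarrow> \<psi>) \<^bold>\<and> (\<psi> \<^bold>\<longrightarrow> \<phi>)"

primrec ren :: "('b, 'c) tm \<Rightarrow> (nat \<Rightarrow> nat) \<Rightarrow> ('b, 'c) tm" where
  "ren (Var n) \<rho> = Var (\<rho> n)"
| "ren (Cst k) \<rho> = Cst k"
| "ren Star \<rho> = Star"
| "ren (Pr a b) \<rho> = Pr (ren a \<rho>) (ren b \<rho>)"
| "ren (Fst a) \<rho> = Fst (ren a \<rho>)"
| "ren (Snd a) \<rho> = Snd (ren a \<rho>)"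
| "ren (Compr A \<phi>) \<rho> = Compr A (ren \<phi> (case_nat 0 (\<lambda>n. Suc (\<rho> n))))"
| "ren (a \<^bold>\<in> b) \<rho> = (ren a \<rho> \<^bold>\<in> ren b \<rho>)"
| "ren (a \<^bold>= b) \<rho> = (ren a \<rho> \<^bold>= ren b \<rho>)"
| "ren \<^bold>\<top> \<rho> = \<^bold>\<top>"
| "ren \<^bold>\<bottom> \<rho> = \<^bold>\<bottom>"
| "ren (\<phi> \<^bold>\<and> \<psi>) \<rho> = (ren \<phi> \<rho> \<^bold>\<and> ren \<psi> \<rho>)"
| "ren (\<phi> \<^bold>\<or> \<psi>) \<rho> = (ren \<phi> \<rho> \<^bold>\<or> ren \<psi> \<rho>)"
| "ren (\<phi> \<^bold>\<longrightarrow> \<psi>) \<rho> = (ren \<phi> \<rho> \<^bold>\<longrightarrow> ren \<psi> \<rho>)"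
| "ren (\<^bold>\<forall>[A]. \<phi>) \<rho> = (\<^bold>\<forall>[A]. ren \<phi> (case_nat 0 (\<lambda>n. Suc (\<rho> n))))"
| "ren (\<^bold>\<exists>[A]. \<phi>) \<rho> = (\<^bold>\<exists>[A]. ren \<phi> (case_nat 0 (\<lambda>n. Suc (\<rho> n))))"

text \<open>Weakening by one fresh variable: \<open>t\<up>\<close> is \<open>t\<close> seen under one more binder.\<close>

abbreviation wk :: "('b, 'c) tm \<Rightarrow> ('b, 'c) tm"  ("_\<up>" [1000] 1000) where
  "t\<up> \<equiv> ren t Suc"

primrec sub :: "('b, 'c) tm \<Rightarrow> (nat \<Rightarrow> ('b, 'c) tm) \<Rightarrow> ('b, 'c) tm" where
  "sub (Var n) \<sigma> = \<sigma> n"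
| "sub (Cst k) \<sigma> = Cst k"
| "sub Star \<sigma> = Star"
| "sub (Pr a b) \<sigma> = Pr (sub a \<sigma>) (sub b \<sigma>)"
| "sub (Fst a) \<sigma> = Fst (sub a \<sigma>)"
| "sub (Snd a) \<sigma> = Snd (sub a \<sigma>)"
| "sub (Compr A \<phi>) \<sigma> = Compr A (sub \<phi> (case_nat (Var 0) (\<lambda>n. (\<sigma> n)\<up>)))"
| "sub (a \<^bold>\<in> b) \<sigma> = (sub a \<sigma> \<^bold>\<in> sub b \<sigma>)"
| "sub (a \<^bold>= b) \<sigma> = (sub a \<sigma> \<^bold>= sub b \<sigma>)"
| "sub \<^bold>\<top> \<sigma> = \<^bold>\<top>"
| "sub \<^bold>\<bottom> \<sigma> = \<^bold>\<bottom>"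
| "sub (\<phi> \<^bold>\<and> \<psi>) \<sigma> = (sub \<phi> \<sigma> \<^bold>\<and> sub \<psi> \<sigma>)"
| "sub (\<phi> \<^bold>\<or> \<psi>) \<sigma> = (sub \<phi> \<sigma> \<^bold>\<or> sub \<psi> \<sigma>)"
| "sub (\<phi> \<^bold>\<longrightarrow> \<psi>) \<sigma> = (sub \<phi> \<sigma> \<^bold>\<longrightarrow> sub \<psi> \<sigma>)"
| "sub (\<^bold>\<forall>[A]. \<phi>) \<sigma> = (\<^bold>\<forall>[A]. sub \<phi> (case_nat (Var 0) (\<lambda>n. (\<sigma> n)\<up>)))"
| "sub (\<^bold>\<exists>[A]. \<phi>) \<sigma> = (\<^bold>\<exists>[A]. sub \<phi> (case_nat (Var 0) (\<lambda>n. (\<sigma> n)\<up>)))"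

definition inst :: "('b, 'c) tm \<Rightarrow> ('b, 'c) tm \<Rightarrow> ('b, 'c) tm" where
  "inst \<phi> a = sub \<phi> (case_nat a Var)"

inductive typed :: "('c \<Rightarrow> 'b ty) \<Rightarrow> 'b ty list \<Rightarrow> ('b, 'c) tm \<Rightarrow> 'b ty \<Rightarrow> bool"
  for sg :: "'c \<Rightarrow> 'b ty" where
  Var: "n < length \<Gamma> \<Longrightarrow> typed sg \<Gamma> (Var n) (\<Gamma> ! n)"
| Cst: "typed sg \<Gamma> (Cst k) (sg k)"
| Star: "typed sg \<Gamma> Star One"
| Pr: "typed sg \<Gamma> a A \<Longrightarrow> typed sg \<Gamma> b B \<Longrightarrow> typed sg \<Gamma> (Pr a b) (Prod A B)"
| Fst: "typed sg \<Gamma> c (Prod A B) \<Longrightarrow> typed sg \<Gamma> (Fst c) A"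
| Snd: "typed sg \<Gamma> c (Prod A B) \<Longrightarrow> typed sg \<Gamma> (Snd c) B"
| Compr: "typed sg (A # \<Gamma>) \<phi> Omega \<Longrightarrow> typed sg \<Gamma> (Compr A \<phi>) (Power A)"
| In: "typed sg \<Gamma> a A \<Longrightarrow> typed sg \<Gamma> b (Power A) \<Longrightarrow> typed sg \<Gamma> (a \<^bold>\<in> b) Omega"
| Equ: "typed sg \<Gamma> a A \<Longrightarrow> typed sg \<Gamma> b A \<Longrightarrow> typed sg \<Gamma> (a \<^bold>= b) Omega"
| Tru: "typed sg \<Gamma> \<^bold>\<top> Omega"
| Fls: "typed sg \<Gamma> \<^bold>\<bottom> Omega"
| Conj: "typed sg \<Gamma> \<phi> Omega \<Longrightarrow> typed sg \<Gamma> \<psi> Omega \<Longrightarrow> typed sg \<Gamma> (\<phi> \<^bold>\<and> \<psi>) Omega"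
| Disj: "typed sg \<Gamma> \<phi> Omega \<Longrightarrow> typed sg \<Gamma> \<psi> Omega \<Longrightarrow> typed sg \<Gamma> (\<phi> \<^bold>\<or> \<psi>) Omega"
| Impl: "typed sg \<Gamma> \<phi> Omega \<Longrightarrow> typed sg \<Gamma> \<psi> Omega \<Longrightarrow> typed sg \<Gamma> (\<phi> \<^bold>\<longrightarrow> \<psi>) Omega"
| Forall: "typed sg (A # \<Gamma>) \<phi> Omega \<Longrightarrow> typed sg \<Gamma> (\<^bold>\<forall>[A]. \<phi>) Omega"
| Exist: "typed sg (A # \<Gamma>) \<phi> Omega \<Longrightarrow> typed sg \<Gamma> (\<^bold>\<exists>[A]. \<phi>) Omega"

text \<open>
  \<open>entails sg \<Gamma> \<Delta> \<phi>\<close>: in the variable context \<open>\<Gamma>\<close>, the possibly infinite set \<open>\<Delta>\<close> of hypotheses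
  entails \<open>\<phi>\<close>. The context is part of the judgement because base types may be empty.
\<close>

inductive entails ::
  "('c \<Rightarrow> 'b ty) \<Rightarrow> 'b ty list \<Rightarrow> ('b, 'c) tm set \<Rightarrow> ('b, 'c) tm \<Rightarrow> bool"
  for sg :: "'c \<Rightarrow> 'b ty" where
  hyp: "\<phi> \<in> \<Delta> \<Longrightarrow> typed sg \<Gamma> \<phi> Omega \<Longrightarrow> entails sg \<Gamma> \<Delta> \<phi>"
| truI: "entails sg \<Gamma> \<Delta> \<^bold>\<top>"
| flsE: "entails sg \<Gamma> \<Delta> \<^bold>\<bottom> \<Longrightarrow> typed sg \<Gamma> \<phi> Omega \<Longrightarrow> entails sg \<Gamma> \<Delta> \<phi>"
| conjI: "entails sg \<Gamma> \<Delta> \<phi> \<Longrightarrow> entails sg \<Gamma> \<Delta> \<psi> \<Longrightarrow> entails sg \<Gamma> \<Delta> (\<phi> \<^bold>\<and> \<psi>)"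
| conjE1: "entails sg \<Gamma> \<Delta> (\<phi> \<^bold>\<and> \<psi>) \<Longrightarrow> entails sg \<Gamma> \<Delta> \<phi>"
| conjE2: "entails sg \<Gamma> \<Delta> (\<phi> \<^bold>\<and> \<psi>) \<Longrightarrow> entails sg \<Gamma> \<Delta> \<psi>"
| disjI1: "entails sg \<Gamma> \<Delta> \<phi> \<Longrightarrow> typed sg \<Gamma> \<psi> Omega \<Longrightarrow> entails sg \<Gamma> \<Delta> (\<phi> \<^bold>\<or> \<psi>)"
| disjI2: "entails sg \<Gamma> \<Delta> \<psi> \<Longrightarrow> typed sg \<Gamma> \<phi> Omega \<Longrightarrow> entails sg \<Gamma> \<Delta> (\<phi> \<^bold>\<or> \<psi>)"
| disjE: "entails sg \<Gamma> \<Delta> (\<phi> \<^bold>\<or> \<psi>) \<Longrightarrow> entails sg \<Gamma> (insert \<phi> \<Delta>) \<chi> \<Longrightarrow>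
    entails sg \<Gamma> (insert \<psi> \<Delta>) \<chi> \<Longrightarrow> entails sg \<Gamma> \<Delta> \<chi>"
| implI: "typed sg \<Gamma> \<phi> Omega \<Longrightarrow> entails sg \<Gamma> (insert \<phi> \<Delta>) \<psi> \<Longrightarrow> entails sg \<Gamma> \<Delta> (\<phi> \<^bold>\<longrightarrow> \<psi>)"
| implE: "entails sg \<Gamma> \<Delta> (\<phi> \<^bold>\<longrightarrow> \<psi>) \<Longrightarrow> entails sg \<Gamma> \<Delta> \<phi> \<Longrightarrow> entails sg \<Gamma> \<Delta> \<psi>"
| forallI: "entails sg (A # \<Gamma>) (wk ` \<Delta>) \<phi> \<Longrightarrow> entails sg \<Gamma> \<Delta> (\<^bold>\<forall>[A]. \<phi>)"
| forallE: "entails sg \<Gamma> \<Delta> (\<^bold>\<forall>[A]. \<phi>) \<Longrightarrow> typed sg \<Gamma> a A \<Longrightarrow> entails sg \<Gamma> \<Delta> (inst \<phi> a)"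
| existI: "typed sg (A # \<Gamma>) \<phi> Omega \<Longrightarrow> typed sg \<Gamma> a A \<Longrightarrow> entails sg \<Gamma> \<Delta> (inst \<phi> a) \<Longrightarrow>
    entails sg \<Gamma> \<Delta> (\<^bold>\<exists>[A]. \<phi>)"
| existE: "entails sg \<Gamma> \<Delta> (\<^bold>\<exists>[A]. \<phi>) \<Longrightarrow> typed sg \<Gamma> \<chi> Omega \<Longrightarrow>
    entails sg (A # \<Gamma>) (insert \<phi> (wk ` \<Delta>)) (\<chi>\<up>) \<Longrightarrow> entails sg \<Gamma> \<Delta> \<chi>"
| refl: "typed sg \<Gamma> a A \<Longrightarrow> entails sg \<Gamma> \<Delta> (a \<^bold>= a)"
| subst: "entails sg \<Gamma> \<Delta> (a \<^bold>= b) \<Longrightarrow> typed sg \<Gamma> a A \<Longrightarrow> typed sg \<Gamma> b A \<Longrightarrow>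
    typed sg (A # \<Gamma>) \<phi> Omega \<Longrightarrow> entails sg \<Gamma> \<Delta> (inst \<phi> a) \<Longrightarrow> entails sg \<Gamma> \<Delta> (inst \<phi> b)"
| prop_ext: "entails sg \<Gamma> \<Delta> (\<phi> \<^bold>\<longleftrightarrow> \<psi>) \<Longrightarrow> entails sg \<Gamma> \<Delta> (\<phi> \<^bold>= \<psi>)"
| set_ext: "typed sg \<Gamma> a (Power A) \<Longrightarrow> typed sg \<Gamma> b (Power A) \<Longrightarrow>
    entails sg \<Gamma> \<Delta> (\<^bold>\<forall>[A]. (Var 0 \<^bold>\<in> a\<up> \<^bold>\<longleftrightarrow> Var 0 \<^bold>\<in> b\<up>)) \<Longrightarrow> entails sg \<Gamma> \<Delta> (a \<^bold>= b)"
| compr: "typed sg (A # \<Gamma>) \<phi> Omega \<Longrightarrow> typed sg \<Gamma> a A \<Longrightarrow>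
    entails sg \<Gamma> \<Delta> (a \<^bold>\<in> Compr A \<phi> \<^bold>\<longleftrightarrow> inst \<phi> a)"
| fst: "typed sg \<Gamma> a A \<Longrightarrow> typed sg \<Gamma> b B \<Longrightarrow> entails sg \<Gamma> \<Delta> (Fst (Pr a b) \<^bold>= a)"
| snd: "typed sg \<Gamma> a A \<Longrightarrow> typed sg \<Gamma> b B \<Longrightarrow> entails sg \<Gamma> \<Delta> (Snd (Pr a b) \<^bold>= b)"
| pair: "typed sg \<Gamma> c (Prod A B) \<Longrightarrow> entails sg \<Gamma> \<Delta> (Pr (Fst c) (Snd c) \<^bold>= c)"
| star: "typed sg \<Gamma> a One \<Longrightarrow> entails sg \<Gamma> \<Delta> (a \<^bold>= Star)"

text \<open>
  ``Some \<open>x : A\<close> satisfies all formulas of \<open>\<Psi>\<close>'', where \<open>\<Psi>\<close> may be an infinite schema in the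
  variables \<open>A # \<Gamma>\<close>: whatever follows from \<open>\<Psi>\<close> for a fresh \<open>x\<close>, without mentioning \<open>x\<close>, holds.
  For \<open>\<Psi> = {\<psi>}\<close> this is derivability of \<open>\<^bold>\<exists>[A]. \<psi>\<close>; it holds whenever all of \<open>\<Psi>\<close> is derivable for
  some term \<open>a\<close> of type \<open>A\<close>.
\<close>

definition entails_some ::
  "('c \<Rightarrow> 'b ty) \<Rightarrow> 'b ty list \<Rightarrow> ('b, 'c) tm set \<Rightarrow> 'b ty \<Rightarrow> ('b, 'c) tm set \<Rightarrow> bool" where
  "entails_some sg \<Gamma> \<Delta> A \<Psi> \<longleftrightarrow>
     (\<forall>\<chi>. typed sg \<Gamma> \<chi> Omega \<longrightarrow> entails sg (A # \<Gamma>) (wk ` \<Delta> \<union> \<Psi>) (\<chi>\<up>) \<longrightarrow> entails sg \<Gamma> \<Delta> \<chi>)"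


section \<open>Test, open and closed truth values and subsets\<close>

text \<open>
  A set is a subset \<open>X : Power A\<close> of some type \<open>A\<close>, so that sets depending on parameters are included.
  Below, \<open>T : Power Omega\<close> is the set of test truth values.
\<close>

definition opens :: "('b, 'c) tm \<Rightarrow> ('b, 'c) tm" where
  "opens T = Compr Omega (\<^bold>\<forall>[Omega]. (Var 0 \<^bold>\<in> T\<up>\<up> \<^bold>\<longrightarrow> (Var 1 \<^bold>\<and> Var 0) \<^bold>\<in> T\<up>\<up>))"

definition closeds :: "('b, 'c) tm \<Rightarrow> ('b, 'c) tm" where
  "closeds T = Compr Omega (\<^bold>\<forall>[Omega]. (Var 0 \<^bold>\<in> T\<up>\<up> \<^bold>\<longrightarrow> (Var 1 \<^bold>\<longrightarrow> Var 0) \<^bold>\<in> T\<up>\<up>))"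

definition subset_of :: "'b ty \<Rightarrow> ('b, 'c) tm \<Rightarrow> ('b, 'c) tm \<Rightarrow> ('b, 'c) tm" where
  "subset_of A U X = (\<^bold>\<forall>[A]. (Var 0 \<^bold>\<in> U\<up> \<^bold>\<longrightarrow> Var 0 \<^bold>\<in> X\<up>))"

text \<open>For all \<open>x \<in> X\<close> the truth value of \<open>x \<in> U\<close> is in \<open>S\<close>.\<close>

definition values_in :: "('b, 'c) tm \<Rightarrow> 'b ty \<Rightarrow> ('b, 'c) tm \<Rightarrow> ('b, 'c) tm \<Rightarrow> ('b, 'c) tm" where
  "values_in S A U X = (\<^bold>\<forall>[A]. (Var 0 \<^bold>\<in> X\<up> \<^bold>\<longrightarrow> (Var 0 \<^bold>\<in> U\<up>) \<^bold>\<in> S\<up>))"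

definition test_subset :: "('b, 'c) tm \<Rightarrow> 'b ty \<Rightarrow> ('b, 'c) tm \<Rightarrow> ('b, 'c) tm \<Rightarrow> ('b, 'c) tm" where
  "test_subset T A U X = (subset_of A U X \<^bold>\<and> values_in T A U X)"

definition open_subset :: "('b, 'c) tm \<Rightarrow> 'b ty \<Rightarrow> ('b, 'c) tm \<Rightarrow> ('b, 'c) tm \<Rightarrow> ('b, 'c) tm" where
  "open_subset T A U X = (subset_of A U X \<^bold>\<and> values_in (opens T) A U X)"

definition closed_subset :: "('b, 'c) tm \<Rightarrow> 'b ty \<Rightarrow> ('b, 'c) tm \<Rightarrow> ('b, 'c) tm \<Rightarrow> ('b, 'c) tm" where
  "closed_subset T A U X = (subset_of A U X \<^bold>\<and> values_in (closeds T) A U X)"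

definition intersection :: "'b ty \<Rightarrow> ('b, 'c) tm \<Rightarrow> ('b, 'c) tm \<Rightarrow> ('b, 'c) tm" where
  "intersection A U V = Compr A (Var 0 \<^bold>\<in> U\<up> \<^bold>\<and> Var 0 \<^bold>\<in> V\<up>)"

definition subspace :: "('b, 'c) tm \<Rightarrow> 'b ty \<Rightarrow> ('b, 'c) tm \<Rightarrow> ('b, 'c) tm \<Rightarrow> ('b, 'c) tm" where
  "subspace T A U X =
     (subset_of A U X \<^bold>\<and>
      (\<^bold>\<forall>[Power A]. (test_subset (T\<up>) A (Var 0) (U\<up>) \<^bold>\<longrightarrow>
         (\<^bold>\<exists>[Power A]. (test_subset (T\<up>\<up>) A (Var 0) (X\<up>\<up>) \<^bold>\<and>
            Var 1 \<^bold>= intersection A (U\<up>\<up>) (Var 0))))))"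

definition strongly_open :: "('b, 'c) tm \<Rightarrow> 'b ty \<Rightarrow> ('b, 'c) tm \<Rightarrow> ('b, 'c) tm \<Rightarrow> ('b, 'c) tm" where
  "strongly_open T A U X = (open_subset T A U X \<^bold>\<and> subspace T A U X)"

definition strongly_closed :: "('b, 'c) tm \<Rightarrow> 'b ty \<Rightarrow> ('b, 'c) tm \<Rightarrow> ('b, 'c) tm \<Rightarrow> ('b, 'c) tm" where
  "strongly_closed T A U X = (closed_subset T A U X \<^bold>\<and> subspace T A U X)"

definition dominance :: "('b, 'c) tm \<Rightarrow> ('b, 'c) tm" where
  "dominance T =
     (\<^bold>\<forall>[Omega]. (Var 0 \<^bold>\<in> opens (T\<up>) \<^bold>\<longrightarrow>
        (\<^bold>\<forall>[Omega]. ((Var 1 \<^bold>\<longrightarrow> Var 0 \<^bold>\<in> T\<up>\<up>) \<^bold>\<longrightarrow> (Var 1 \<^bold>\<and> Var 0) \<^bold>\<in> T\<up>\<up>))))"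

definition codominance :: "('b, 'c) tm \<Rightarrow> ('b, 'c) tm" where
  "codominance T =
     (\<^bold>\<forall>[Omega]. (Var 0 \<^bold>\<in> closeds (T\<up>) \<^bold>\<longrightarrow>
        (\<^bold>\<forall>[Omega]. ((Var 1 \<^bold>\<longrightarrow> Var 0 \<^bold>\<in> T\<up>\<up>) \<^bold>\<longrightarrow> (Var 1 \<^bold>\<longrightarrow> Var 0) \<^bold>\<in> T\<up>\<up>))))"


section \<open>Classes of subsets\<close>

text \<open>
  A class of subsets is a parameter \<open>K\<close>, to be instantiated by \<open>strongly_open\<close> and
  \<open>strongly_closed\<close>: \<open>K T A U X\<close> is the formula ``\<open>U\<close> is a subset of \<open>X\<close> that belongs to the class'',
  for \<open>U, X : Power A\<close>.

  The truth value \<open>u\<close> corresponds to the subset \<open>{x : One | u}\<close> of \<open>{x : One | \<^bold>\<top>}\<close>.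
\<close>

definition class_values ::
  "(('b, 'c) tm \<Rightarrow> 'b ty \<Rightarrow> ('b, 'c) tm \<Rightarrow> ('b, 'c) tm \<Rightarrow> ('b, 'c) tm) \<Rightarrow> ('b, 'c) tm \<Rightarrow> ('b, 'c) tm" where
  "class_values K T = Compr Omega (K (T\<up>) One (Compr One (Var 1)) (Compr One \<^bold>\<top>))"

text \<open>The bound variables are \<open>X\<close> and \<open>U\<close>.\<close>

definition classified_by ::
  "(('b, 'c) tm \<Rightarrow> 'b ty \<Rightarrow> ('b, 'c) tm \<Rightarrow> ('b, 'c) tm \<Rightarrow> ('b, 'c) tm) \<Rightarrow>
   ('b, 'c) tm \<Rightarrow> ('b, 'c) tm \<Rightarrow> 'b ty \<Rightarrow> ('b, 'c) tm" where
  "classified_by K T S A =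
     (\<^bold>\<forall>[Power A]. \<^bold>\<forall>[Power A]. (subset_of A (Var 0) (Var 1) \<^bold>\<longrightarrow>
        (K (T\<up>\<up>) A (Var 0) (Var 1) \<^bold>\<longleftrightarrow> values_in (S\<up>\<up>) A (Var 0) (Var 1))))"

text \<open>\<open>F : Power (Prod A B)\<close> is the graph of a map from \<open>X\<close> to \<open>Y\<close>.\<close>

definition is_map ::
  "'b ty \<Rightarrow> 'b ty \<Rightarrow> ('b, 'c) tm \<Rightarrow> ('b, 'c) tm \<Rightarrow> ('b, 'c) tm \<Rightarrow> ('b, 'c) tm" where
  "is_map A B F X Y =
     ((\<^bold>\<forall>[A]. \<^bold>\<forall>[B]. (Pr (Var 1) (Var 0) \<^bold>\<in> F\<up>\<up> \<^bold>\<longrightarrow> Var 1 \<^bold>\<in> X\<up>\<up> \<^bold>\<and> Var 0 \<^bold>\<in> Y\<up>\<up>)) \<^bold>\<and>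
      (\<^bold>\<forall>[A]. (Var 0 \<^bold>\<in> X\<up> \<^bold>\<longrightarrow>
         (\<^bold>\<exists>[B]. (Pr (Var 1) (Var 0) \<^bold>\<in> F\<up>\<up> \<^bold>\<and>
            (\<^bold>\<forall>[B]. (Pr (Var 2) (Var 0) \<^bold>\<in> F\<up>\<up>\<up> \<^bold>\<longrightarrow> Var 0 \<^bold>= Var 1)))))))"

definition preimage :: "'b ty \<Rightarrow> 'b ty \<Rightarrow> ('b, 'c) tm \<Rightarrow> ('b, 'c) tm \<Rightarrow> ('b, 'c) tm" where
  "preimage A B F V = Compr A (\<^bold>\<exists>[B]. (Pr (Var 1) (Var 0) \<^bold>\<in> F\<up>\<up> \<^bold>\<and> Var 0 \<^bold>\<in> V\<up>\<up>))"

text \<open>The bound variables are \<open>X\<close>, \<open>Y\<close>, the graph of the map, and \<open>V\<close>.\<close>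

definition maps_continuous ::
  "(('b, 'c) tm \<Rightarrow> 'b ty \<Rightarrow> ('b, 'c) tm \<Rightarrow> ('b, 'c) tm \<Rightarrow> ('b, 'c) tm) \<Rightarrow>
   ('b, 'c) tm \<Rightarrow> 'b ty \<Rightarrow> 'b ty \<Rightarrow> ('b, 'c) tm" where
  "maps_continuous K T A B =
     (\<^bold>\<forall>[Power A]. \<^bold>\<forall>[Power B]. \<^bold>\<forall>[Power (Prod A B)].
        (is_map A B (Var 0) (Var 2) (Var 1) \<^bold>\<longrightarrow>
         (\<^bold>\<forall>[Power B]. (K (T\<up>\<up>\<up>\<up>) B (Var 0) (Var 2) \<^bold>\<longrightarrow>
            K (T\<up>\<up>\<up>\<up>) A (preimage A B (Var 1) (Var 0)) (Var 3)))))"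

text \<open>
  A schematic statement holds under the hypotheses \<open>\<Delta>\<close> if all its instances (one for each choice of
  types) are derivable from \<open>\<Delta>\<close>. Since \<open>\<Delta>\<close> is arbitrary, equivalence of two statements for all
  \<open>\<Gamma>\<close> and \<open>\<Delta>\<close> amounts to each being derivable from (the instances of) the other.
\<close>

definition classified ::
  "('c \<Rightarrow> 'b ty) \<Rightarrow> 'b ty list \<Rightarrow> ('b, 'c) tm set \<Rightarrow>
   (('b, 'c) tm \<Rightarrow> 'b ty \<Rightarrow> ('b, 'c) tm \<Rightarrow> ('b, 'c) tm \<Rightarrow> ('b, 'c) tm) \<Rightarrow>
   ('b, 'c) tm \<Rightarrow> ('b, 'c) tm \<Rightarrow> bool" where
  "classified sg \<Gamma> \<Delta> K T S \<longleftrightarrow> (\<forall>A. entails sg \<Gamma> \<Delta> (classified_by K T S A))"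

definition classified_by_some ::
  "('c \<Rightarrow> 'b ty) \<Rightarrow> 'b ty list \<Rightarrow> ('b, 'c) tm set \<Rightarrow>
   (('b, 'c) tm \<Rightarrow> 'b ty \<Rightarrow> ('b, 'c) tm \<Rightarrow> ('b, 'c) tm \<Rightarrow> ('b, 'c) tm) \<Rightarrow> ('b, 'c) tm \<Rightarrow> bool" where
  "classified_by_some sg \<Gamma> \<Delta> K T \<longleftrightarrow>
     entails_some sg \<Gamma> \<Delta> (Power Omega) (range (classified_by K (T\<up>) (Var 0)))"

definition all_maps_continuous ::
  "('c \<Rightarrow> 'b ty) \<Rightarrow> 'b ty list \<Rightarrow> ('b, 'c) tm set \<Rightarrow>
   (('b, 'c) tm \<Rightarrow> 'b ty \<Rightarrow> ('b, 'c) tm \<Rightarrow> ('b, 'c) tm \<Rightarrow> ('b, 'c) tm) \<Rightarrow> ('b, 'c) tm \<Rightarrow> bool" where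
  "all_maps_continuous sg \<Gamma> \<Delta> K T \<longleftrightarrow> (\<forall>A B. entails sg \<Gamma> \<Delta> (maps_continuous K T A B))"

end

theory Submission
  imports Defs
begin

text \<open>
  Both halves are one argument. Let \<open>c\<close> be conjunction or implication, and call a truth value \<open>u\<close>
  admissible if \<open>c u t \<in> T\<close> for all \<open>t \<in> T\<close>; these are the open truth values if \<open>c\<close> is conjunction and
  the closed ones if it is implication. Dominance and codominance both say that \<open>c u p \<in> T\<close> whenever
  \<open>u\<close> is admissible and \<open>u\<close> implies \<open>p \<in> T\<close>. Two properties of \<open>c\<close> carry the proof: \<open>u \<and> c u p\<close> is
  equivalent to \<open>u \<and> p\<close>, and \<open>c u p\<close> depends, up to equivalence, only on \<open>u\<close> and \<open>u \<and> p\<close>.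

  \<^item> If dominance holds, a subset \<open>U \<subseteq> X\<close> with admissible truth values is automatically a subspace: a test
    subset \<open>B\<close> of \<open>U\<close> extends to \<open>{x \<in> X | c (x \<in> U) (x \<in> B)}\<close>, which is a test subset of \<open>X\<close> by
    dominance and meets \<open>U\<close> in \<open>B\<close> by the first property (\<open>dominant_subspace\<close>). So being strong is the
    same as having admissible truth values. Over a singleton this identifies the truth values of strong
    subsets with the admissible ones, and so strong subsets are classified by them.
  \<^item> If strong subsets are classified by some \<open>S\<close>, then preimages of strong subsets are strong, because
    the truth value of \<open>x \<in> f\<^sup>-\<^sup>1(V)\<close> is that of \<open>f(x) \<in> V\<close> (\<open>strong_preimage\<close>).
  \<^item> In any case, the subset \<open>{\<top>}\<close> of the set \<open>W\<close> of admissible truth values is strong: the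
    truth value of \<open>u \<in> {\<top>}\<close> is \<open>u\<close> itself, and a test subset \<open>B\<close> of \<open>{\<top>}\<close> extends to
    \<open>{u \<in> W | \<top> \<in> B}\<close>, whose truth values are all the test value of \<open>\<top> \<in> B\<close> (\<open>true_part_strong\<close>). If
    maps are continuous, pulling \<open>{\<top>}\<close> back along the map from a singleton to \<open>W\<close> with value \<open>u\<close> shows that
    \<open>{* | u}\<close> is strong in \<open>{*}\<close>. When \<open>u\<close> implies \<open>p \<in> T\<close>, the set \<open>{* | u \<and> p}\<close> is a test subset of
    it and extends to a test subset of \<open>{*}\<close>; that is, \<open>u \<and> p\<close> equals \<open>u \<and> t\<close> for some \<open>t \<in> T\<close>. By the
    second property, \<open>c u p\<close> equals \<open>c u t\<close>, which is in \<open>T\<close> (\<open>dominant_instance\<close>).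

  Every step is intuitionistic, and each is carried out as a derivation. To keep bound variables out of
  sight, the facts above are stated for arbitrary well-typed terms in arbitrary contexts; a bound variable
  then is just the term \<open>Var 0\<close> in a longer context.
\<close>

section \<open>Renaming and substitution\<close>

lemma ren_ren: "ren (ren t \<rho>) \<rho>' = ren t (\<lambda>n. \<rho>' (\<rho> n))"
  by (induction t arbitrary: \<rho> \<rho>')
    (auto intro!: arg_cong[where f = "ren _"] ext split: nat.split)

lemma sub_ren: "sub (ren t \<rho>) \<sigma> = sub t (\<lambda>n. \<sigma> (\<rho> n))"
  by (induction t arbitrary: \<rho> \<sigma>)
    (auto intro!: arg_cong[where f = "sub _"] ext split: nat.split)

lemma ren_sub: "ren (sub t \<sigma>) \<rho> = sub t (\<lambda>n. ren (\<sigma> n) \<rho>)"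
  by (induction t arbitrary: \<rho> \<sigma>)
    (auto intro!: arg_cong[where f = "sub _"] ext simp: ren_ren split: nat.split)

lemma sub_sub: "sub (sub t \<sigma>) \<tau> = sub t (\<lambda>n. sub (\<sigma> n) \<tau>)"
  by (induction t arbitrary: \<sigma> \<tau>)
    (auto intro!: arg_cong[where f = "sub _"] ext simp: sub_ren ren_sub split: nat.split)

text \<open>
  The rules \<open>ren_lift\<close>, \<open>sub_lift\<close> and \<open>sub_wk\<close> below evaluate renamings and instances of formulas whose
  parameters are weakened terms, at any depth of binders, without unfolding the parameters. Together with
  \<open>case_nat_Var\<close> they make instances of all defined formulas computable by simplification.
\<close>

lemma case_nat_Var [simp]: "case_nat (Var 0) (\<lambda>n. Var (Suc n)) = Var"
  by (auto split: nat.split)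

lemma sub_Var [simp]: "sub t Var = t"
  by (induction t) auto

lemma ren_lift [simp]: "ren (t\<up>) (case_nat 0 (\<lambda>n. Suc (\<rho> n))) = (ren t \<rho>)\<up>"
  by (simp add: ren_ren)

lemma ren_id [simp]: "ren t (\<lambda>n. n) = t"
proof -
  have "case_nat 0 (\<lambda>n. Suc n) = (\<lambda>n. n)" by (auto split: nat.split)
  then show ?thesis by (induction t) auto
qed

lemma sub_lift [simp]: "sub (t\<up>) (case_nat (Var 0) (\<lambda>n. (\<sigma> n)\<up>)) = (sub t \<sigma>)\<up>"
  by (simp add: sub_ren ren_sub)

lemma sub_wk [simp]: "sub (t\<up>) (case_nat a Var) = t"
  by (simp add: sub_ren)

lemma ren_inst: "ren (inst \<phi> a) \<rho> = inst (ren \<phi> (case_nat 0 (\<lambda>n. Suc (\<rho> n)))) (ren a \<rho>)"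
  by (auto simp: inst_def sub_ren ren_sub intro!: arg_cong[where f = "sub _"] ext split: nat.split)

lemma sub_inst:
  "sub (inst \<phi> a) \<sigma> = inst (sub \<phi> (case_nat (Var 0) (\<lambda>n. (\<sigma> n)\<up>))) (sub a \<sigma>)"
  by (auto simp: inst_def sub_ren sub_sub intro!: arg_cong[where f = "sub _"] ext split: nat.split)


section \<open>Typing\<close>

definition typed_ren :: "'b ty list \<Rightarrow> (nat \<Rightarrow> nat) \<Rightarrow> 'b ty list \<Rightarrow> bool" where
  "typed_ren \<Gamma>' \<rho> \<Gamma> \<longleftrightarrow> (\<forall>n<length \<Gamma>. \<rho> n < length \<Gamma>' \<and> \<Gamma>' ! \<rho> n = \<Gamma> ! n)"

definition typed_sub ::
  "('c \<Rightarrow> 'b ty) \<Rightarrow> 'b ty list \<Rightarrow> (nat \<Rightarrow> ('b, 'c) tm) \<Rightarrow> 'b ty list \<Rightarrow> bool" where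
  "typed_sub sg \<Gamma>' \<sigma> \<Gamma> \<longleftrightarrow> (\<forall>n<length \<Gamma>. typed sg \<Gamma>' (\<sigma> n) (\<Gamma> ! n))"

lemma typed_ren_Suc: "typed_ren (A # \<Gamma>) Suc \<Gamma>"
  by (simp add: typed_ren_def)

lemma typed_ren_lift:
  "typed_ren \<Gamma>' \<rho> \<Gamma> \<Longrightarrow> typed_ren (A # \<Gamma>') (case_nat 0 (\<lambda>n. Suc (\<rho> n))) (A # \<Gamma>)"
  by (auto simp: typed_ren_def less_Suc_eq_0_disj)

lemma typed_renD: "typed sg \<Gamma> t A \<Longrightarrow> typed_ren \<Gamma>' \<rho> \<Gamma> \<Longrightarrow> typed sg \<Gamma>' (ren t \<rho>) A"
proof (induction arbitrary: \<Gamma>' \<rho> rule: typed.induct)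
  case (Var n \<Gamma>)
  then show ?case by (metis ren.simps(1) typed.Var typed_ren_def)
qed (fastforce intro: typed.intros typed_ren_lift)+

lemma typed_wk: "typed sg \<Gamma> t A \<Longrightarrow> typed sg (B # \<Gamma>) (t\<up>) A"
  by (rule typed_renD[OF _ typed_ren_Suc])

lemma typed_sub_lift:
  assumes "typed_sub sg \<Gamma>' \<sigma> \<Gamma>"
  shows "typed_sub sg (A # \<Gamma>') (case_nat (Var 0) (\<lambda>n. (\<sigma> n)\<up>)) (A # \<Gamma>)"
  using assms typed.Var[of 0 "A # \<Gamma>'" sg]
  by (auto simp: typed_sub_def less_Suc_eq_0_disj intro!: typed_wk)

lemma typed_subD: "typed sg \<Gamma> t A \<Longrightarrow> typed_sub sg \<Gamma>' \<sigma> \<Gamma> \<Longrightarrow> typed sg \<Gamma>' (sub t \<sigma>) A"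
proof (induction arbitrary: \<Gamma>' \<sigma> rule: typed.induct)
  case (Var n \<Gamma>)
  then show ?case by (simp add: typed_sub_def)
qed (fastforce intro: typed.intros typed_sub_lift)+

lemma typed_sub_inst: "typed sg \<Gamma> a A \<Longrightarrow> typed_sub sg \<Gamma> (case_nat a Var) (A # \<Gamma>)"
  by (auto simp: typed_sub_def less_Suc_eq_0_disj intro: typed.Var)

lemma typed_inst: "typed sg (A # \<Gamma>) \<phi> B \<Longrightarrow> typed sg \<Gamma> a A \<Longrightarrow> typed sg \<Gamma> (inst \<phi> a) B"
  unfolding inst_def by (rule typed_subD[OF _ typed_sub_inst])

inductive_simps typed_simps [simp]:
  "typed sg \<Gamma> (Var n) A"
  "typed sg \<Gamma> (Compr B \<phi>) A"
  "typed sg \<Gamma> \<^bold>\<top> A"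
  "typed sg \<Gamma> Star A"
  "typed sg \<Gamma> (Pr a b) A"
  "typed sg \<Gamma> (a \<^bold>\<in> b) A"
  "typed sg \<Gamma> (a \<^bold>= b) A"
  "typed sg \<Gamma> (\<phi> \<^bold>\<and> \<psi>) A"
  "typed sg \<Gamma> (\<phi> \<^bold>\<or> \<psi>) A"
  "typed sg \<Gamma> (\<phi> \<^bold>\<longrightarrow> \<psi>) A"
  "typed sg \<Gamma> (\<^bold>\<forall>[B]. \<phi>) A"
  "typed sg \<Gamma> (\<^bold>\<exists>[B]. \<phi>) A"


section \<open>Structural rules\<close>

text \<open>
  Ill-typed hypotheses do no harm because the rule \<open>hyp\<close> uses a hypothesis only if it is well-typed.
\<close>

lemma entails_typed: "entails sg \<Gamma> \<Delta> \<phi> \<Longrightarrow> typed sg \<Gamma> \<phi> Omega"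
proof (induction rule: entails.induct)
  case (subst \<Gamma> \<Delta> a b A \<phi>)
  then show ?case by (blast intro: typed_inst)
next
  case (compr A \<Gamma> \<phi> a \<Delta>)
  then show ?case by (auto intro: typed_inst)
qed (auto intro: typed.intros typed_inst)

lemma entails_ren:
  "entails sg \<Gamma> \<Delta> \<phi> \<Longrightarrow> typed_ren \<Gamma>' \<rho> \<Gamma> \<Longrightarrow> \<forall>\<psi>\<in>\<Delta>. ren \<psi> \<rho> \<in> \<Delta>' \<Longrightarrow>
    entails sg \<Gamma>' \<Delta>' (ren \<phi> \<rho>)"
proof (induction arbitrary: \<Gamma>' \<Delta>' \<rho> rule: entails.induct)
  case (hyp \<phi> \<Delta> \<Gamma>)
  then show ?case by (auto intro: entails.hyp typed_renD)
next
  case (disjE \<Gamma> \<Delta> \<phi> \<psi> \<chi>)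
  show ?case
    by (rule entails.disjE[of _ _ _ "ren \<phi> \<rho>" "ren \<psi> \<rho>"])
      (use disjE.IH(1)[OF disjE.prems] in simp,
        rule disjE.IH(2), use disjE.prems in auto, rule disjE.IH(3), use disjE.prems in auto)
next
  case (implI \<Gamma> \<phi> \<Delta> \<psi>)
  then show ?case by (auto intro!: entails.implI typed_renD)
next
  case implE
  then show ?case by (simp, blast intro: entails.implE)
next
  case (forallI A \<Gamma> \<Delta> \<phi>)
  show ?case
    by (simp, rule entails.forallI, rule forallI.IH[OF typed_ren_lift])
      (use forallI.prems in auto)
next
  case (forallE \<Gamma> \<Delta> A \<phi> a)
  then show ?case by (auto simp: ren_inst intro!: entails.forallE typed_renD)
next
  case (existI A \<Gamma> \<phi> a \<Delta>)
  then show ?case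
    by (auto simp: ren_inst intro!: entails.existI typed_renD typed_ren_lift)
next
  case (existE \<Gamma> \<Delta> A \<phi> \<chi>)
  show ?case
  proof (rule entails.existE)
    show "entails sg \<Gamma>' \<Delta>' (\<^bold>\<exists>[A]. ren \<phi> (case_nat 0 (\<lambda>n. Suc (\<rho> n))))"
      using existE.IH(1)[OF existE.prems] by simp
    show "typed sg \<Gamma>' (ren \<chi> \<rho>) Omega" using existE by (blast intro: typed_renD)
    show "entails sg (A # \<Gamma>')
        (insert (ren \<phi> (case_nat 0 (\<lambda>n. Suc (\<rho> n)))) (wk ` \<Delta>')) ((ren \<chi> \<rho>)\<up>)"
      by (rule existE.IH(2)[OF typed_ren_lift, simplified]) (use existE.prems in auto)
  qed
next
  case (subst \<Gamma> \<Delta> a b A \<phi>)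
  show ?case unfolding ren_inst
    by (rule entails.subst[of _ _ _ "ren a \<rho>" _ A])
      (use subst in \<open>auto simp: ren_inst[symmetric] intro!: typed_renD typed_ren_lift\<close>)
next
  case (set_ext \<Gamma> a A b \<Delta>)
  show ?case
    using set_ext.IH[OF set_ext.prems] set_ext.hyps set_ext.prems
    by (auto intro!: entails.set_ext intro: typed_renD)
next
  case (compr A \<Gamma> \<phi> a \<Delta>)
  then show ?case
    by (simp only: ren.simps ren_inst) (auto intro!: entails.compr typed_renD typed_ren_lift)
next
  case (pair \<Gamma> c A B \<Delta>)
  then show ?case by (auto intro: entails.pair typed_renD)
qed (auto intro: entails.intros typed_renD entails.implE)

lemma entails_mono:
  assumes "entails sg \<Gamma> \<Delta> \<phi>" and "\<Delta> \<subseteq> \<Delta>'"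
  shows "entails sg \<Gamma> \<Delta>' \<phi>"
  using entails_ren[OF assms(1), of \<Gamma> "\<lambda>n. n" \<Delta>'] assms(2) by (auto simp: typed_ren_def)

lemma entails_wk:
  assumes "entails sg \<Gamma> \<Delta> \<phi>" and "wk ` \<Delta> \<subseteq> \<Delta>'"
  shows "entails sg (A # \<Gamma>) \<Delta>' (\<phi>\<up>)"
  by (rule entails_ren[OF assms(1) typed_ren_Suc]) (use assms(2) in auto)

text \<open>
  Substitution and cut in a single induction. Cutting all hypotheses at once covers infinite sets of
  hypotheses, which cannot be discharged one after the other; this is what instantiates the schema of
  classification statements in \<open>classified_by_some_if_classified\<close>.
\<close>

lemma entails_sub:
  "entails sg \<Gamma> \<Delta> \<phi> \<Longrightarrow> typed_sub sg \<Gamma>' \<sigma> \<Gamma> \<Longrightarrow>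
    \<forall>\<psi>\<in>\<Delta>. entails sg \<Gamma>' \<Delta>' (sub \<psi> \<sigma>) \<Longrightarrow>
    entails sg \<Gamma>' \<Delta>' (sub \<phi> \<sigma>)"
proof (induction arbitrary: \<Gamma>' \<Delta>' \<sigma> rule: entails.induct)
  case (hyp \<phi> \<Delta> \<Gamma>)
  then show ?case by auto
next
  case (disjE \<Gamma> \<Delta> \<phi> \<psi> \<chi>)
  have "typed sg \<Gamma> \<phi> Omega" "typed sg \<Gamma> \<psi> Omega" using entails_typed[OF disjE.hyps(1)] by auto
  note [intro] = typed_subD[OF this(1) disjE.prems(1)] typed_subD[OF this(2) disjE.prems(1)]
  show ?case
    by (rule entails.disjE[of _ _ _ "sub \<phi> \<sigma>" "sub \<psi> \<sigma>"])
      (use disjE.IH(1)[OF disjE.prems] in simp,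
        rule disjE.IH(2), use disjE.prems in \<open>auto intro: entails_mono entails.hyp typed_subD\<close>,
        rule disjE.IH(3), use disjE.prems in \<open>auto intro: entails_mono entails.hyp typed_subD\<close>)
next
  case (implI \<Gamma> \<phi> \<Delta> \<psi>)
  show ?case
    by (simp, rule entails.implI)
      (use implI.hyps implI.prems in \<open>auto intro!: implI.IH intro: entails_mono entails.hyp typed_subD\<close>)
next
  case implE
  then show ?case by (simp, blast intro: entails.implE)
next
  case (forallI A \<Gamma> \<Delta> \<phi>)
  show ?case
    by (simp, rule entails.forallI, rule forallI.IH[OF typed_sub_lift])
      (use forallI.prems in \<open>auto intro: entails_wk\<close>)
next
  case (forallE \<Gamma> \<Delta> A \<phi> a)
  then show ?case by (auto simp: sub_inst intro!: entails.forallE typed_subD)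
next
  case (existI A \<Gamma> \<phi> a \<Delta>)
  then show ?case
    by (auto simp: sub_inst intro!: entails.existI typed_subD typed_sub_lift)
next
  case (existE \<Gamma> \<Delta> A \<phi> \<chi>)
  have "typed sg (A # \<Gamma>) \<phi> Omega" using entails_typed[OF existE.hyps(1)] by simp
  note [intro] = typed_subD[OF this typed_sub_lift[OF existE.prems(1)]]
  show ?case
  proof (rule entails.existE)
    show "entails sg \<Gamma>' \<Delta>' (\<^bold>\<exists>[A]. sub \<phi> (case_nat (Var 0) (\<lambda>n. (\<sigma> n)\<up>)))"
      using existE.IH(1)[OF existE.prems] by simp
    show "typed sg \<Gamma>' (sub \<chi> \<sigma>) Omega" using existE by (blast intro: typed_subD)
    show "entails sg (A # \<Gamma>')
        (insert (sub \<phi> (case_nat (Var 0) (\<lambda>n. (\<sigma> n)\<up>))) (wk ` \<Delta>')) ((sub \<chi> \<sigma>)\<up>)"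
      by (rule existE.IH(2)[OF typed_sub_lift, simplified])
        (use existE.prems in \<open>auto intro: entails_wk entails.hyp typed_subD typed_sub_lift\<close>)
  qed
next
  case (subst \<Gamma> \<Delta> a b A \<phi>)
  show ?case unfolding sub_inst
    by (rule entails.subst[of _ _ _ "sub a \<sigma>" _ A])
      (use subst in \<open>auto simp: sub_inst[symmetric] intro!: typed_subD typed_sub_lift\<close>)
next
  case (set_ext \<Gamma> a A b \<Delta>)
  show ?case
    using set_ext.IH[OF set_ext.prems] set_ext.hyps set_ext.prems
    by (auto intro!: entails.set_ext intro: typed_subD)
next
  case (compr A \<Gamma> \<phi> a \<Delta>)
  then show ?case
    by (simp only: sub.simps sub_inst) (auto intro!: entails.compr typed_subD typed_sub_lift)
next
  case (pair \<Gamma> c A B \<Delta>)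
  then show ?case by (auto intro: entails.pair typed_subD)
qed (auto intro: entails.intros typed_subD entails.implE)

section \<open>Derived rules\<close>

text \<open>
  Rules that discharge a hypothesis are restated in the style of Kripke semantics: instead of inserting
  the hypothesis into the set, they range over all larger sets from which it is derivable. A hypothetical
  derivation thus becomes an implication between judgements, and derivability itself can be rewritten.
\<close>

lemma implI':
  assumes "typed sg \<Gamma> \<phi> Omega"
    and "\<And>\<Delta>'. \<Delta> \<subseteq> \<Delta>' \<Longrightarrow> entails sg \<Gamma> \<Delta>' \<phi> \<Longrightarrow> entails sg \<Gamma> \<Delta>' \<psi>"
  shows "entails sg \<Gamma> \<Delta> (\<phi> \<^bold>\<longrightarrow> \<psi>)"
  by (rule entails.implI[OF assms(1)], rule assms(2)) (auto intro: entails.hyp assms(1))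

lemma iffI':
  assumes "typed sg \<Gamma> \<phi> Omega" and "typed sg \<Gamma> \<psi> Omega"
    and "\<And>\<Delta>'. \<Delta> \<subseteq> \<Delta>' \<Longrightarrow> entails sg \<Gamma> \<Delta>' \<phi> \<Longrightarrow> entails sg \<Gamma> \<Delta>' \<psi>"
    and "\<And>\<Delta>'. \<Delta> \<subseteq> \<Delta>' \<Longrightarrow> entails sg \<Gamma> \<Delta>' \<psi> \<Longrightarrow> entails sg \<Gamma> \<Delta>' \<phi>"
  shows "entails sg \<Gamma> \<Delta> (\<phi> \<^bold>\<longleftrightarrow> \<psi>)"
proof (rule entails.conjI)
  show "entails sg \<Gamma> \<Delta> (\<phi> \<^bold>\<longrightarrow> \<psi>)" by (rule implI'[OF assms(1,3)])
  show "entails sg \<Gamma> \<Delta> (\<psi> \<^bold>\<longrightarrow> \<phi>)" by (rule implI'[OF assms(2,4)])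
qed

lemma iffD1: "entails sg \<Gamma> \<Delta> (\<phi> \<^bold>\<longleftrightarrow> \<psi>) \<Longrightarrow> entails sg \<Gamma> \<Delta> \<phi> \<Longrightarrow> entails sg \<Gamma> \<Delta> \<psi>"
  by (rule entails.implE[OF entails.conjE1])

lemma iffD2: "entails sg \<Gamma> \<Delta> (\<phi> \<^bold>\<longleftrightarrow> \<psi>) \<Longrightarrow> entails sg \<Gamma> \<Delta> \<psi> \<Longrightarrow> entails sg \<Gamma> \<Delta> \<phi>"
  by (rule entails.implE[OF entails.conjE2])

lemma iff_sym: "entails sg \<Gamma> \<Delta> (\<phi> \<^bold>\<longleftrightarrow> \<psi>) \<Longrightarrow> entails sg \<Gamma> \<Delta> (\<psi> \<^bold>\<longleftrightarrow> \<phi>)"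
  by (rule entails.conjI[OF entails.conjE2 entails.conjE1])

lemma entails_conj: "entails sg \<Gamma> \<Delta> (\<phi> \<^bold>\<and> \<psi>) \<longleftrightarrow> entails sg \<Gamma> \<Delta> \<phi> \<and> entails sg \<Gamma> \<Delta> \<psi>"
  by (auto intro: entails.conjI dest: entails.conjE1 entails.conjE2)

lemma all_memI:
  assumes "typed sg \<Gamma> X (Power A)"
    and "\<And>\<Delta>'. wk ` \<Delta> \<subseteq> \<Delta>' \<Longrightarrow> entails sg (A # \<Gamma>) \<Delta>' (Var 0 \<^bold>\<in> X\<up>) \<Longrightarrow>
      entails sg (A # \<Gamma>) \<Delta>' \<phi>"
  shows "entails sg \<Gamma> \<Delta> (\<^bold>\<forall>[A]. (Var 0 \<^bold>\<in> X\<up> \<^bold>\<longrightarrow> \<phi>))"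
  by (intro entails.forallI implI' assms(2)) (auto intro!: exI typed_wk assms(1))

lemma all_memD:
  assumes "entails sg \<Gamma> \<Delta> (\<^bold>\<forall>[A]. (Var 0 \<^bold>\<in> X\<up> \<^bold>\<longrightarrow> \<phi>))"
    and "typed sg \<Gamma> a A" and "entails sg \<Gamma> \<Delta> (a \<^bold>\<in> X)"
  shows "entails sg \<Gamma> \<Delta> (inst \<phi> a)"
  using entails.forallE[OF assms(1,2)] assms(3) by (auto simp: inst_def intro: entails.implE)

lemma existE':
  assumes "entails sg \<Gamma> \<Delta> (\<^bold>\<exists>[A]. \<phi>)" and "typed sg \<Gamma> \<chi> Omega"
    and "\<And>\<Delta>'. wk ` \<Delta> \<subseteq> \<Delta>' \<Longrightarrow> entails sg (A # \<Gamma>) \<Delta>' \<phi> \<Longrightarrow> entails sg (A # \<Gamma>) \<Delta>' (\<chi>\<up>)"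
  shows "entails sg \<Gamma> \<Delta> \<chi>"
proof (rule entails.existE[OF assms(1,2)], rule assms(3))
  show "entails sg (A # \<Gamma>) (insert \<phi> (wk ` \<Delta>)) \<phi>"
    using entails_typed[OF assms(1)] by (auto intro: entails.hyp)
qed auto

lemma entails_mem_Compr:
  assumes "typed sg (A # \<Gamma>) \<phi> Omega" and "typed sg \<Gamma> a A"
  shows "entails sg \<Gamma> \<Delta> (a \<^bold>\<in> Compr A \<phi>) \<longleftrightarrow> entails sg \<Gamma> \<Delta> (inst \<phi> a)"
  using entails.compr[OF assms, of \<Delta>] by (blast intro: iffD1 iffD2)

lemma eq_sym:
  assumes "entails sg \<Gamma> \<Delta> (a \<^bold>= b)" and "typed sg \<Gamma> a A" and "typed sg \<Gamma> b A"
  shows "entails sg \<Gamma> \<Delta> (b \<^bold>= a)"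
  using entails.subst[OF assms, of "Var 0 \<^bold>= a\<up>"] assms(2)
  by (auto simp: inst_def intro!: exI intro: typed_wk entails.refl)

lemma eq_mem:
  assumes "entails sg \<Gamma> \<Delta> (a \<^bold>= b)" and "typed sg \<Gamma> a A" and "typed sg \<Gamma> b A"
    and "typed sg \<Gamma> V (Power A)" and "entails sg \<Gamma> \<Delta> (a \<^bold>\<in> V)"
  shows "entails sg \<Gamma> \<Delta> (b \<^bold>\<in> V)"
  using entails.subst[OF assms(1-3), of "Var 0 \<^bold>\<in> V\<up>"] assms(4,5)
  by (auto simp: inst_def intro!: exI intro: typed_wk)

lemma mem_eq:
  assumes "entails sg \<Gamma> \<Delta> (U \<^bold>= V)" and "typed sg \<Gamma> U (Power A)" and "typed sg \<Gamma> V (Power A)"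
    and "typed sg \<Gamma> a A"
  shows "entails sg \<Gamma> \<Delta> (a \<^bold>\<in> U) \<longleftrightarrow> entails sg \<Gamma> \<Delta> (a \<^bold>\<in> V)"
proof -
  have \<phi>: "typed sg (Power A # \<Gamma>) (a\<up> \<^bold>\<in> Var 0) Omega"
    using assms(4) by (auto intro!: exI typed_wk)
  show ?thesis
    using entails.subst[OF assms(1-3) \<phi>] entails.subst[OF eq_sym[OF assms(1-3)] assms(3,2) \<phi>]
    by (auto simp: inst_def)
qed

lemma iff_mem:
  assumes "entails sg \<Gamma> \<Delta> (\<phi> \<^bold>\<longleftrightarrow> \<psi>)" and "typed sg \<Gamma> S (Power Omega)"
    and "entails sg \<Gamma> \<Delta> (\<psi> \<^bold>\<in> S)"
  shows "entails sg \<Gamma> \<Delta> (\<phi> \<^bold>\<in> S)"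
proof (rule eq_mem[OF entails.prop_ext[OF iff_sym[OF assms(1)]] _ _ assms(2,3)])
  show "typed sg \<Gamma> \<psi> Omega" "typed sg \<Gamma> \<phi> Omega" using entails_typed[OF assms(1)] by auto
qed

lemma eq_top:
  assumes "entails sg \<Gamma> \<Delta> \<phi>"
  shows "entails sg \<Gamma> \<Delta> (\<^bold>\<top> \<^bold>= \<phi>)"
  by (intro entails.prop_ext iffI') (auto intro: entails_mono assms entails.truI entails_typed[OF assms])

lemma set_extI:
  assumes "typed sg \<Gamma> a (Power A)" and "typed sg \<Gamma> b (Power A)"
    and "\<And>\<Delta>'. wk ` \<Delta> \<subseteq> \<Delta>' \<Longrightarrow> entails sg (A # \<Gamma>) \<Delta>' (Var 0 \<^bold>\<in> a\<up>) \<Longrightarrow>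
      entails sg (A # \<Gamma>) \<Delta>' (Var 0 \<^bold>\<in> b\<up>)"
    and "\<And>\<Delta>'. wk ` \<Delta> \<subseteq> \<Delta>' \<Longrightarrow> entails sg (A # \<Gamma>) \<Delta>' (Var 0 \<^bold>\<in> b\<up>) \<Longrightarrow>
      entails sg (A # \<Gamma>) \<Delta>' (Var 0 \<^bold>\<in> a\<up>)"
  shows "entails sg \<Gamma> \<Delta> (a \<^bold>= b)"
  by (rule entails.set_ext[OF assms(1,2)], rule entails.forallI, rule iffI'[OF _ _ assms(3,4)])
    (auto intro!: exI typed_wk assms(1,2))


section \<open>Subsets and maps\<close>

lemma ren_subset_of [simp]: "ren (subset_of A U X) \<rho> = subset_of A (ren U \<rho>) (ren X \<rho>)"
  by (simp add: subset_of_def)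

lemma sub_subset_of [simp]: "sub (subset_of A U X) \<sigma> = subset_of A (sub U \<sigma>) (sub X \<sigma>)"
  by (simp add: subset_of_def)

lemma typed_subset_of [intro!]:
  "typed sg \<Gamma> U (Power A) \<Longrightarrow> typed sg \<Gamma> X (Power A) \<Longrightarrow> typed sg \<Gamma> (subset_of A U X) Omega"
  by (auto simp: subset_of_def intro!: exI typed_wk)

lemma ren_values_in [simp]:
  "ren (values_in S A U X) \<rho> = values_in (ren S \<rho>) A (ren U \<rho>) (ren X \<rho>)"
  by (simp add: values_in_def)

lemma sub_values_in [simp]:
  "sub (values_in S A U X) \<sigma> = values_in (sub S \<sigma>) A (sub U \<sigma>) (sub X \<sigma>)"
  by (simp add: values_in_def)

lemma typed_values_in [intro!]:
  "typed sg \<Gamma> S (Power Omega) \<Longrightarrow> typed sg \<Gamma> U (Power A) \<Longrightarrow> typed sg \<Gamma> X (Power A) \<Longrightarrow>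
    typed sg \<Gamma> (values_in S A U X) Omega"
  by (auto simp: values_in_def intro!: exI typed_wk)

lemma ren_test_subset [simp]:
  "ren (test_subset T A U X) \<rho> = test_subset (ren T \<rho>) A (ren U \<rho>) (ren X \<rho>)"
  by (simp add: test_subset_def)

lemma sub_test_subset [simp]:
  "sub (test_subset T A U X) \<sigma> = test_subset (sub T \<sigma>) A (sub U \<sigma>) (sub X \<sigma>)"
  by (simp add: test_subset_def)

lemma typed_test_subset [intro!]:
  "typed sg \<Gamma> T (Power Omega) \<Longrightarrow> typed sg \<Gamma> U (Power A) \<Longrightarrow> typed sg \<Gamma> X (Power A) \<Longrightarrow>
    typed sg \<Gamma> (test_subset T A U X) Omega"
  by (auto simp: test_subset_def)

lemma ren_intersection [simp]:
  "ren (intersection A U V) \<rho> = intersection A (ren U \<rho>) (ren V \<rho>)"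
  by (simp add: intersection_def)

lemma sub_intersection [simp]:
  "sub (intersection A U V) \<sigma> = intersection A (sub U \<sigma>) (sub V \<sigma>)"
  by (simp add: intersection_def)

lemma typed_intersection [intro!]:
  "typed sg \<Gamma> U (Power A) \<Longrightarrow> typed sg \<Gamma> V (Power A) \<Longrightarrow>
    typed sg \<Gamma> (intersection A U V) (Power A)"
  by (auto simp: intersection_def intro!: exI typed_wk)

lemma ren_subspace [simp]:
  "ren (subspace T A U X) \<rho> = subspace (ren T \<rho>) A (ren U \<rho>) (ren X \<rho>)"
  by (simp add: subspace_def)

lemma sub_subspace [simp]:
  "sub (subspace T A U X) \<sigma> = subspace (sub T \<sigma>) A (sub U \<sigma>) (sub X \<sigma>)"
  by (simp add: subspace_def)

lemma typed_subspace [intro!]: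
  "typed sg \<Gamma> T (Power Omega) \<Longrightarrow> typed sg \<Gamma> U (Power A) \<Longrightarrow> typed sg \<Gamma> X (Power A) \<Longrightarrow>
    typed sg \<Gamma> (subspace T A U X) Omega"
  by (auto simp: subspace_def intro!: exI[of _ "Power A"] typed_wk)

lemma ren_preimage [simp]:
  "ren (preimage A B F V) \<rho> = preimage A B (ren F \<rho>) (ren V \<rho>)"
  by (simp add: preimage_def)

lemma sub_preimage [simp]:
  "sub (preimage A B F V) \<sigma> = preimage A B (sub F \<sigma>) (sub V \<sigma>)"
  by (simp add: preimage_def)

lemma typed_preimage [intro!]:
  "typed sg \<Gamma> F (Power (Prod A B)) \<Longrightarrow> typed sg \<Gamma> V (Power B) \<Longrightarrow>
    typed sg \<Gamma> (preimage A B F V) (Power A)"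
  by (auto simp: preimage_def intro!: exI typed_wk)

lemma ren_is_map [simp]:
  "ren (is_map A B F X Y) \<rho> = is_map A B (ren F \<rho>) (ren X \<rho>) (ren Y \<rho>)"
  by (simp add: is_map_def numeral_2_eq_2)

lemma sub_is_map [simp]:
  "sub (is_map A B F X Y) \<sigma> = is_map A B (sub F \<sigma>) (sub X \<sigma>) (sub Y \<sigma>)"
  by (simp add: is_map_def numeral_2_eq_2)

lemma typed_is_map [intro!]:
  "typed sg \<Gamma> F (Power (Prod A B)) \<Longrightarrow> typed sg \<Gamma> X (Power A) \<Longrightarrow> typed sg \<Gamma> Y (Power B) \<Longrightarrow>
    typed sg \<Gamma> (is_map A B F X Y) Omega"
  by (auto simp: is_map_def intro!: exI typed_wk)

lemma subset_ofI:
  assumes "typed sg \<Gamma> U (Power A)"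
    and "\<And>\<Delta>'. wk ` \<Delta> \<subseteq> \<Delta>' \<Longrightarrow> entails sg (A # \<Gamma>) \<Delta>' (Var 0 \<^bold>\<in> U\<up>) \<Longrightarrow>
      entails sg (A # \<Gamma>) \<Delta>' (Var 0 \<^bold>\<in> X\<up>)"
  shows "entails sg \<Gamma> \<Delta> (subset_of A U X)"
  unfolding subset_of_def by (intro all_memI assms)

lemma subset_ofD:
  assumes "entails sg \<Gamma> \<Delta> (subset_of A U X)" "typed sg \<Gamma> a A" "entails sg \<Gamma> \<Delta> (a \<^bold>\<in> U)"
  shows "entails sg \<Gamma> \<Delta> (a \<^bold>\<in> X)"
  using all_memD[OF assms[unfolded subset_of_def]] by (simp add: inst_def)

lemma values_inI:
  assumes "typed sg \<Gamma> X (Power A)"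
    and "\<And>\<Delta>'. wk ` \<Delta> \<subseteq> \<Delta>' \<Longrightarrow> entails sg (A # \<Gamma>) \<Delta>' (Var 0 \<^bold>\<in> X\<up>) \<Longrightarrow>
      entails sg (A # \<Gamma>) \<Delta>' ((Var 0 \<^bold>\<in> U\<up>) \<^bold>\<in> S\<up>)"
  shows "entails sg \<Gamma> \<Delta> (values_in S A U X)"
  unfolding values_in_def by (intro all_memI assms)

lemma values_inD:
  assumes "entails sg \<Gamma> \<Delta> (values_in S A U X)" "typed sg \<Gamma> a A" "entails sg \<Gamma> \<Delta> (a \<^bold>\<in> X)"
  shows "entails sg \<Gamma> \<Delta> ((a \<^bold>\<in> U) \<^bold>\<in> S)"
  using all_memD[OF assms[unfolded values_in_def]] by (simp add: inst_def)

lemma entails_mem_intersection: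
  assumes "typed sg \<Gamma> U (Power A)" "typed sg \<Gamma> V (Power A)" "typed sg \<Gamma> a A"
  shows "entails sg \<Gamma> \<Delta> (a \<^bold>\<in> intersection A U V) \<longleftrightarrow>
    entails sg \<Gamma> \<Delta> (a \<^bold>\<in> U) \<and> entails sg \<Gamma> \<Delta> (a \<^bold>\<in> V)"
  unfolding intersection_def
  by (subst entails_mem_Compr) (use assms in \<open>auto simp: inst_def entails_conj intro!: exI typed_wk\<close>)

lemma subspaceI:
  assumes "typed sg \<Gamma> T (Power Omega)" "typed sg \<Gamma> U (Power A)" "typed sg \<Gamma> X (Power A)"
    and "typed sg (Power A # \<Gamma>) C (Power A)"
    and "entails sg \<Gamma> \<Delta> (subset_of A U X)"
    and "\<And>\<Delta>'. wk ` \<Delta> \<subseteq> \<Delta>' \<Longrightarrow> entails sg (Power A # \<Gamma>) \<Delta>' (test_subset (T\<up>) A (Var 0) (U\<up>)) \<Longrightarrow>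
      entails sg (Power A # \<Gamma>) \<Delta>' (test_subset (T\<up>) A C (X\<up>)) \<and>
      entails sg (Power A # \<Gamma>) \<Delta>' (Var 0 \<^bold>= intersection A (U\<up>) C)"
  shows "entails sg \<Gamma> \<Delta> (subspace T A U X)"
  unfolding subspace_def
proof (intro entails.conjI assms(5) entails.forallI implI')
  fix \<Delta>' assume *: "wk ` \<Delta> \<subseteq> \<Delta>'" "entails sg (Power A # \<Gamma>) \<Delta>' (test_subset (T\<up>) A (Var 0) (U\<up>))"
  show "entails sg (Power A # \<Gamma>) \<Delta>' (\<^bold>\<exists>[Power A]. (test_subset (T\<up>\<up>) A (Var 0) (X\<up>\<up>) \<^bold>\<and>
            Var 1 \<^bold>= intersection A (U\<up>\<up>) (Var 0)))"
    by (rule entails.existI[OF _ assms(4)])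
      (use assms(1-4) assms(6)[OF *] in
        \<open>auto simp: inst_def entails_conj intro!: exI[of _ "Power A"] typed_wk\<close>)
qed (use assms(1-3) in \<open>auto intro!: typed_wk\<close>)

lemma subspaceE:
  assumes "entails sg \<Gamma> \<Delta> (subspace T A U X)"
    and "typed sg \<Gamma> B (Power A)" and "entails sg \<Gamma> \<Delta> (test_subset T A B U)"
    and "typed sg \<Gamma> \<chi> Omega"
    and "\<And>\<Delta>'. wk ` \<Delta> \<subseteq> \<Delta>' \<Longrightarrow>
      entails sg (Power A # \<Gamma>) \<Delta>' (test_subset (T\<up>) A (Var 0) (X\<up>)) \<Longrightarrow>
      entails sg (Power A # \<Gamma>) \<Delta>' (B\<up> \<^bold>= intersection A (U\<up>) (Var 0)) \<Longrightarrow>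
      entails sg (Power A # \<Gamma>) \<Delta>' (\<chi>\<up>)"
  shows "entails sg \<Gamma> \<Delta> \<chi>"
proof (rule existE'[OF _ assms(4)])
  have "entails sg \<Gamma> \<Delta> (\<^bold>\<forall>[Power A]. (test_subset (T\<up>) A (Var 0) (U\<up>) \<^bold>\<longrightarrow>
         (\<^bold>\<exists>[Power A]. (test_subset (T\<up>\<up>) A (Var 0) (X\<up>\<up>) \<^bold>\<and>
            Var 1 \<^bold>= intersection A (U\<up>\<up>) (Var 0)))))"
    using assms(1) by (simp add: subspace_def entails_conj)
  from entails.forallE[OF this assms(2)] assms(3)
  show "entails sg \<Gamma> \<Delta> (\<^bold>\<exists>[Power A]. (test_subset (T\<up>) A (Var 0) (X\<up>) \<^bold>\<and>
            B\<up> \<^bold>= intersection A (U\<up>) (Var 0)))"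
    by (auto simp: inst_def intro: entails.implE)
qed (use assms(5) in \<open>auto simp: entails_conj\<close>)

text \<open>
  The value of the map at the generic element \<open>Var 0\<close> of \<open>X\<close> is given by the term \<open>b\<close>.
\<close>

lemma is_mapI:
  assumes "typed sg \<Gamma> F (Power (Prod A B))" "typed sg \<Gamma> X (Power A)"
    and "typed sg (A # \<Gamma>) b B"
    and "\<And>\<Delta>'. (wk ` wk ` \<Delta>) \<subseteq> \<Delta>' \<Longrightarrow> entails sg (B # A # \<Gamma>) \<Delta>' (Pr (Var 1) (Var 0) \<^bold>\<in> F\<up>\<up>) \<Longrightarrow>
      entails sg (B # A # \<Gamma>) \<Delta>' (Var 1 \<^bold>\<in> X\<up>\<up>) \<and> entails sg (B # A # \<Gamma>) \<Delta>' (Var 0 \<^bold>\<in> Y\<up>\<up>)"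
    and "\<And>\<Delta>'. wk ` \<Delta> \<subseteq> \<Delta>' \<Longrightarrow> entails sg (A # \<Gamma>) \<Delta>' (Var 0 \<^bold>\<in> X\<up>) \<Longrightarrow>
      entails sg (A # \<Gamma>) \<Delta>' (Pr (Var 0) b \<^bold>\<in> F\<up>)"
    and "\<And>\<Delta>'. (wk ` wk ` \<Delta>) \<subseteq> \<Delta>' \<Longrightarrow> entails sg (B # A # \<Gamma>) \<Delta>' (Var 1 \<^bold>\<in> X\<up>\<up>) \<Longrightarrow>
      entails sg (B # A # \<Gamma>) \<Delta>' (Pr (Var 1) (Var 0) \<^bold>\<in> F\<up>\<up>) \<Longrightarrow>
      entails sg (B # A # \<Gamma>) \<Delta>' (Var 0 \<^bold>= b\<up>)"
  shows "entails sg \<Gamma> \<Delta> (is_map A B F X Y)"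
  unfolding is_map_def
proof (intro entails.conjI[of _ _ _ "\<^bold>\<forall>[_]. _"] entails.forallI implI' all_memI)
  fix \<Delta>' assume *: "wk ` \<Delta> \<subseteq> \<Delta>'" "entails sg (A # \<Gamma>) \<Delta>' (Var 0 \<^bold>\<in> X\<up>)"
  have unique: "entails sg (A # \<Gamma>) \<Delta>' (\<^bold>\<forall>[B]. (Pr (Var 1) (Var 0) \<^bold>\<in> F\<up>\<up> \<^bold>\<longrightarrow> Var 0 \<^bold>= b\<up>))"
  proof (intro entails.forallI implI')
    fix \<Delta>'' assume **: "wk ` \<Delta>' \<subseteq> \<Delta>''"
      "entails sg (B # A # \<Gamma>) \<Delta>'' (Pr (Var 1) (Var 0) \<^bold>\<in> F\<up>\<up>)"
    show "entails sg (B # A # \<Gamma>) \<Delta>'' (Var 0 \<^bold>= b\<up>)"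
      by (rule assms(6)) (use *(1) ** entails_wk[OF *(2) **(1), of B] in auto)
  qed (use assms(1) in \<open>auto intro!: exI typed_wk\<close>)
  show "entails sg (A # \<Gamma>) \<Delta>' (\<^bold>\<exists>[B]. (Pr (Var 1) (Var 0) \<^bold>\<in> F\<up>\<up> \<^bold>\<and>
            (\<^bold>\<forall>[B]. (Pr (Var 2) (Var 0) \<^bold>\<in> F\<up>\<up>\<up> \<^bold>\<longrightarrow> Var 0 \<^bold>= Var 1))))"
    by (rule entails.existI[OF _ assms(3), rotated])
      (use assms(1) unique assms(5)[OF *] in
        \<open>auto simp: inst_def entails_conj numeral_2_eq_2 intro!: exI typed_wk\<close>)
qed (use assms(1,2,4) in \<open>auto simp: entails_conj intro!: exI typed_wk\<close>)

lemma is_map_mem: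
  assumes "entails sg \<Gamma> \<Delta> (is_map A B F X Y)" "typed sg \<Gamma> a A" "typed sg \<Gamma> b B"
    and "entails sg \<Gamma> \<Delta> (Pr a b \<^bold>\<in> F)"
  shows is_map_domain: "entails sg \<Gamma> \<Delta> (a \<^bold>\<in> X)" and is_map_range: "entails sg \<Gamma> \<Delta> (b \<^bold>\<in> Y)"
proof -
  have "entails sg \<Gamma> \<Delta> (\<^bold>\<forall>[A]. \<^bold>\<forall>[B]. (Pr (Var 1) (Var 0) \<^bold>\<in> F\<up>\<up> \<^bold>\<longrightarrow> Var 1 \<^bold>\<in> X\<up>\<up> \<^bold>\<and> Var 0 \<^bold>\<in> Y\<up>\<up>))"
    using assms(1) by (simp add: is_map_def entails_conj)
  from entails.forallE[OF this assms(2)]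
  have "entails sg \<Gamma> \<Delta> (\<^bold>\<forall>[B]. (Pr (a\<up>) (Var 0) \<^bold>\<in> F\<up> \<^bold>\<longrightarrow> a\<up> \<^bold>\<in> X\<up> \<^bold>\<and> Var 0 \<^bold>\<in> Y\<up>))"
    by (simp add: inst_def)
  from entails.forallE[OF this assms(3)]
  have *: "entails sg \<Gamma> \<Delta> (Pr a b \<^bold>\<in> F \<^bold>\<longrightarrow> a \<^bold>\<in> X \<^bold>\<and> b \<^bold>\<in> Y)"
    by (simp add: inst_def)
  show "entails sg \<Gamma> \<Delta> (a \<^bold>\<in> X)" "entails sg \<Gamma> \<Delta> (b \<^bold>\<in> Y)"
    using entails.implE[OF * assms(4)] by (simp_all add: entails_conj)
qed

lemma is_map_valueE:
  assumes "entails sg \<Gamma> \<Delta> (is_map A B F X Y)" "typed sg \<Gamma> a A" "entails sg \<Gamma> \<Delta> (a \<^bold>\<in> X)"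
    and "typed sg \<Gamma> \<chi> Omega"
    and "\<And>\<Delta>'. wk ` \<Delta> \<subseteq> \<Delta>' \<Longrightarrow> entails sg (B # \<Gamma>) \<Delta>' (Pr (a\<up>) (Var 0) \<^bold>\<in> F\<up>) \<Longrightarrow>
      entails sg (B # \<Gamma>) \<Delta>' (\<^bold>\<forall>[B]. (Pr (a\<up>\<up>) (Var 0) \<^bold>\<in> F\<up>\<up> \<^bold>\<longrightarrow> Var 0 \<^bold>= Var 1)) \<Longrightarrow>
      entails sg (B # \<Gamma>) \<Delta>' (\<chi>\<up>)"
  shows "entails sg \<Gamma> \<Delta> \<chi>"
proof (rule existE'[OF _ assms(4)])
  have "entails sg \<Gamma> \<Delta> (\<^bold>\<forall>[A]. (Var 0 \<^bold>\<in> X\<up> \<^bold>\<longrightarrow>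
         (\<^bold>\<exists>[B]. (Pr (Var 1) (Var 0) \<^bold>\<in> F\<up>\<up> \<^bold>\<and>
            (\<^bold>\<forall>[B]. (Pr (Var 2) (Var 0) \<^bold>\<in> F\<up>\<up>\<up> \<^bold>\<longrightarrow> Var 0 \<^bold>= Var 1))))))"
    using assms(1) by (simp add: is_map_def entails_conj)
  from all_memD[OF this assms(2,3)]
  show "entails sg \<Gamma> \<Delta> (\<^bold>\<exists>[B]. (Pr (a\<up>) (Var 0) \<^bold>\<in> F\<up> \<^bold>\<and>
            (\<^bold>\<forall>[B]. (Pr (a\<up>\<up>) (Var 0) \<^bold>\<in> F\<up>\<up> \<^bold>\<longrightarrow> Var 0 \<^bold>= Var 1))))"
    by (simp add: inst_def numeral_2_eq_2)
qed (use assms(5) in \<open>auto simp: entails_conj\<close>)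

lemma entails_mem_preimage:
  assumes "typed sg \<Gamma> F (Power (Prod A B))" "typed sg \<Gamma> V (Power B)" "typed sg \<Gamma> a A"
  shows "entails sg \<Gamma> \<Delta> (a \<^bold>\<in> preimage A B F V) \<longleftrightarrow>
    entails sg \<Gamma> \<Delta> (\<^bold>\<exists>[B]. (Pr (a\<up>) (Var 0) \<^bold>\<in> F\<up> \<^bold>\<and> Var 0 \<^bold>\<in> V\<up>))"
  unfolding preimage_def
  by (subst entails_mem_Compr) (use assms in \<open>auto simp: inst_def intro!: exI typed_wk\<close>)

lemma preimageI:
  assumes "typed sg \<Gamma> F (Power (Prod A B))" "typed sg \<Gamma> V (Power B)" "typed sg \<Gamma> a A"
    and "typed sg \<Gamma> b B" "entails sg \<Gamma> \<Delta> (Pr a b \<^bold>\<in> F)" "entails sg \<Gamma> \<Delta> (b \<^bold>\<in> V)"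
  shows "entails sg \<Gamma> \<Delta> (a \<^bold>\<in> preimage A B F V)"
  unfolding entails_mem_preimage[OF assms(1-3)]
  by (rule entails.existI[OF _ assms(4)])
    (use assms in \<open>auto simp: inst_def entails_conj intro!: exI typed_wk\<close>)

lemma preimageE:
  assumes "entails sg \<Gamma> \<Delta> (a \<^bold>\<in> preimage A B F V)"
    and "typed sg \<Gamma> F (Power (Prod A B))" "typed sg \<Gamma> V (Power B)" "typed sg \<Gamma> a A"
    and "typed sg \<Gamma> \<chi> Omega"
    and "\<And>\<Delta>'. wk ` \<Delta> \<subseteq> \<Delta>' \<Longrightarrow> entails sg (B # \<Gamma>) \<Delta>' (Pr (a\<up>) (Var 0) \<^bold>\<in> F\<up>) \<Longrightarrow>
      entails sg (B # \<Gamma>) \<Delta>' (Var 0 \<^bold>\<in> V\<up>) \<Longrightarrow> entails sg (B # \<Gamma>) \<Delta>' (\<chi>\<up>)"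
  shows "entails sg \<Gamma> \<Delta> \<chi>"
  by (rule existE'[OF assms(1)[unfolded entails_mem_preimage[OF assms(2-4)]] assms(5)])
    (use assms(6) in \<open>auto simp: entails_conj\<close>)

text \<open>
  Uniqueness of values turns the existential quantifier in the preimage into membership of the value \<open>b\<close>.
\<close>

lemma mem_preimage_iff:
  assumes "typed sg \<Gamma> F (Power (Prod A B))" "typed sg \<Gamma> V (Power B)"
    and "typed sg \<Gamma> a A" "typed sg \<Gamma> b B"
    and "entails sg \<Gamma> \<Delta> (Pr a b \<^bold>\<in> F)"
    and "entails sg \<Gamma> \<Delta> (\<^bold>\<forall>[B]. (Pr (a\<up>) (Var 0) \<^bold>\<in> F\<up> \<^bold>\<longrightarrow> Var 0 \<^bold>= b\<up>))"
  shows "entails sg \<Gamma> \<Delta> (a \<^bold>\<in> preimage A B F V \<^bold>\<longleftrightarrow> b \<^bold>\<in> V)"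
proof (rule iffI')
  show "typed sg \<Gamma> (a \<^bold>\<in> preimage A B F V) Omega" "typed sg \<Gamma> (b \<^bold>\<in> V) Omega"
    using assms(1-4) by (auto intro!: exI)
next
  fix \<Delta>' assume "\<Delta> \<subseteq> \<Delta>'" "entails sg \<Gamma> \<Delta>' (b \<^bold>\<in> V)"
  then show "entails sg \<Gamma> \<Delta>' (a \<^bold>\<in> preimage A B F V)"
    by (blast intro: preimageI assms entails_mono)
next
  fix \<Delta>' assume \<Delta>': "\<Delta> \<subseteq> \<Delta>'" and a: "entails sg \<Gamma> \<Delta>' (a \<^bold>\<in> preimage A B F V)"
  show "entails sg \<Gamma> \<Delta>' (b \<^bold>\<in> V)"
  proof (rule preimageE[OF a assms(1-3)])
    fix \<Delta>'' assume \<Delta>'': "wk ` \<Delta>' \<subseteq> \<Delta>''"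
      and y: "entails sg (B # \<Gamma>) \<Delta>'' (Pr (a\<up>) (Var 0) \<^bold>\<in> F\<up>)"
        "entails sg (B # \<Gamma>) \<Delta>'' (Var 0 \<^bold>\<in> V\<up>)"
    have "entails sg (B # \<Gamma>) \<Delta>'' ((\<^bold>\<forall>[B]. (Pr (a\<up>) (Var 0) \<^bold>\<in> F\<up> \<^bold>\<longrightarrow> Var 0 \<^bold>= b\<up>))\<up>)"
      by (rule entails_wk[OF entails_mono[OF assms(6) \<Delta>'] \<Delta>''])
    from entails.forallE[OF this[simplified], of "Var 0"]
    have "entails sg (B # \<Gamma>) \<Delta>'' (Pr (a\<up>) (Var 0) \<^bold>\<in> F\<up> \<^bold>\<longrightarrow> Var 0 \<^bold>= b\<up>)"
      by (simp add: inst_def)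
    from eq_mem[OF entails.implE[OF this y(1)] _ _ _ y(2)]
    show "entails sg (B # \<Gamma>) \<Delta>'' ((b \<^bold>\<in> V)\<up>)"
      using assms(2,4) by (simp add: typed_wk)
  qed (use assms(2,4) in auto)
qed

section \<open>Open and closed truth values from a common connective\<close>

text \<open>
  The assumption \<open>c_cong\<close> says that \<open>c \<phi> \<psi>\<close> depends only on \<open>\<phi>\<close> and \<open>\<phi> \<and> \<psi>\<close>. Conjunction and
  implication are the intended instances.
\<close>

locale test_connective =
  fixes sg :: "'c \<Rightarrow> 'b ty"
    and c :: "('b, 'c) tm \<Rightarrow> ('b, 'c) tm \<Rightarrow> ('b, 'c) tm"
  assumes ren_c [simp]: "ren (c \<phi> \<psi>) \<rho> = c (ren \<phi> \<rho>) (ren \<psi> \<rho>)"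
    and sub_c [simp]: "sub (c \<phi> \<psi>) \<sigma> = c (sub \<phi> \<sigma>) (sub \<psi> \<sigma>)"
    and typed_c [intro!]:
      "typed sg \<Gamma> \<phi> Omega \<Longrightarrow> typed sg \<Gamma> \<psi> Omega \<Longrightarrow> typed sg \<Gamma> (c \<phi> \<psi>) Omega"
    and conj_c: "typed sg \<Gamma> \<phi> Omega \<Longrightarrow> typed sg \<Gamma> \<psi> Omega \<Longrightarrow>
      entails sg \<Gamma> \<Delta> (\<phi> \<^bold>\<and> c \<phi> \<psi> \<^bold>\<longleftrightarrow> \<phi> \<^bold>\<and> \<psi>)"
    and c_cong: "entails sg \<Gamma> \<Delta> (\<phi> \<^bold>\<and> \<psi> \<^bold>\<longleftrightarrow> \<phi> \<^bold>\<and> \<psi>') \<Longrightarrow>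
      entails sg \<Gamma> \<Delta> (c \<phi> \<psi> \<^bold>\<longleftrightarrow> c \<phi> \<psi>')"
begin

text \<open>
  For conjunction these are the open, for implication the closed truth values; \<open>strong\<close> and \<open>dominant\<close>
  below become strong openness and dominance, or strong closedness and codominance.
\<close>

definition admissible :: "('b, 'c) tm \<Rightarrow> ('b, 'c) tm" where
  "admissible T = Compr Omega (\<^bold>\<forall>[Omega]. (Var 0 \<^bold>\<in> T\<up>\<up> \<^bold>\<longrightarrow> c (Var 1) (Var 0) \<^bold>\<in> T\<up>\<up>))"

definition strong :: "('b, 'c) tm \<Rightarrow> 'b ty \<Rightarrow> ('b, 'c) tm \<Rightarrow> ('b, 'c) tm \<Rightarrow> ('b, 'c) tm" where
  "strong T A U X =
     ((subset_of A U X \<^bold>\<and> values_in (admissible T) A U X) \<^bold>\<and> subspace T A U X)"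

definition dominant :: "('b, 'c) tm \<Rightarrow> ('b, 'c) tm" where
  "dominant T =
     (\<^bold>\<forall>[Omega]. (Var 0 \<^bold>\<in> admissible (T\<up>) \<^bold>\<longrightarrow>
        (\<^bold>\<forall>[Omega]. ((Var 1 \<^bold>\<longrightarrow> Var 0 \<^bold>\<in> T\<up>\<up>) \<^bold>\<longrightarrow> c (Var 1) (Var 0) \<^bold>\<in> T\<up>\<up>))))"

lemma c_top:
  assumes "typed sg \<Gamma> \<psi> Omega"
  shows "entails sg \<Gamma> \<Delta> (c \<^bold>\<top> \<psi> \<^bold>\<longleftrightarrow> \<psi>)"
proof (rule iffI')
  fix \<Delta>' assume "entails sg \<Gamma> \<Delta>' (c \<^bold>\<top> \<psi>)"
  then show "entails sg \<Gamma> \<Delta>' \<psi>"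
    using iffD1[OF conj_c[of \<Gamma> "\<^bold>\<top>" \<psi> \<Delta>']] assms by (auto simp: entails_conj intro: entails.truI)
next
  fix \<Delta>' assume "entails sg \<Gamma> \<Delta>' \<psi>"
  then show "entails sg \<Gamma> \<Delta>' (c \<^bold>\<top> \<psi>)"
    using iffD2[OF conj_c[of \<Gamma> "\<^bold>\<top>" \<psi> \<Delta>']] assms by (auto simp: entails_conj intro: entails.truI)
qed (use assms in auto)

lemma ren_admissible [simp]: "ren (admissible T) \<rho> = admissible (ren T \<rho>)"
  by (simp add: admissible_def)

lemma sub_admissible [simp]: "sub (admissible T) \<sigma> = admissible (sub T \<sigma>)"
  by (simp add: admissible_def)

lemma typed_admissible [intro!]:
  "typed sg \<Gamma> T (Power Omega) \<Longrightarrow> typed sg \<Gamma> (admissible T) (Power Omega)"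
  by (auto simp: admissible_def intro!: exI typed_wk)

lemma ren_strong [simp]:
  "ren (strong T A U X) \<rho> = strong (ren T \<rho>) A (ren U \<rho>) (ren X \<rho>)"
  by (simp add: strong_def)

lemma sub_strong [simp]:
  "sub (strong T A U X) \<sigma> = strong (sub T \<sigma>) A (sub U \<sigma>) (sub X \<sigma>)"
  by (simp add: strong_def)

lemma typed_strong [intro!]:
  "typed sg \<Gamma> T (Power Omega) \<Longrightarrow> typed sg \<Gamma> U (Power A) \<Longrightarrow> typed sg \<Gamma> X (Power A) \<Longrightarrow>
    typed sg \<Gamma> (strong T A U X) Omega"
  by (auto simp: strong_def)

lemma entails_strong:
  "entails sg \<Gamma> \<Delta> (strong T A U X) \<longleftrightarrow> entails sg \<Gamma> \<Delta> (subset_of A U X) \<and>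
    entails sg \<Gamma> \<Delta> (values_in (admissible T) A U X) \<and> entails sg \<Gamma> \<Delta> (subspace T A U X)"
  by (simp add: strong_def entails_conj conj_assoc)

lemma ren_dominant [simp]: "ren (dominant T) \<rho> = dominant (ren T \<rho>)"
  by (simp add: dominant_def)

lemma admissibleI:
  assumes "typed sg \<Gamma> T (Power Omega)" "typed sg \<Gamma> u Omega"
    and "\<And>\<Delta>'. wk ` \<Delta> \<subseteq> \<Delta>' \<Longrightarrow> entails sg (Omega # \<Gamma>) \<Delta>' (Var 0 \<^bold>\<in> T\<up>) \<Longrightarrow>
      entails sg (Omega # \<Gamma>) \<Delta>' (c (u\<up>) (Var 0) \<^bold>\<in> T\<up>)"
  shows "entails sg \<Gamma> \<Delta> (u \<^bold>\<in> admissible T)"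
  unfolding admissible_def
proof (subst entails_mem_Compr)
  show "entails sg \<Gamma> \<Delta> (inst (\<^bold>\<forall>[Omega]. (Var 0 \<^bold>\<in> T\<up>\<up> \<^bold>\<longrightarrow> c (Var 1) (Var 0) \<^bold>\<in> T\<up>\<up>)) u)"
    using all_memI[OF assms(1,3)] by (simp add: inst_def)
qed (use assms(1,2) in \<open>auto intro!: exI typed_wk\<close>)

lemma admissibleD:
  assumes "entails sg \<Gamma> \<Delta> (u \<^bold>\<in> admissible T)"
    and "typed sg \<Gamma> T (Power Omega)" "typed sg \<Gamma> u Omega"
    and "typed sg \<Gamma> t Omega" "entails sg \<Gamma> \<Delta> (t \<^bold>\<in> T)"
  shows "entails sg \<Gamma> \<Delta> (c u t \<^bold>\<in> T)"
proof -
  have "entails sg \<Gamma> \<Delta> (inst (\<^bold>\<forall>[Omega]. (Var 0 \<^bold>\<in> T\<up>\<up> \<^bold>\<longrightarrow> c (Var 1) (Var 0) \<^bold>\<in> T\<up>\<up>)) u)"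
    using assms(1) unfolding admissible_def
    by (subst (asm) entails_mem_Compr) (use assms(2,3) in \<open>auto intro!: exI typed_wk\<close>)
  then have "entails sg \<Gamma> \<Delta> (\<^bold>\<forall>[Omega]. (Var 0 \<^bold>\<in> T\<up> \<^bold>\<longrightarrow> c (u\<up>) (Var 0) \<^bold>\<in> T\<up>))"
    by (simp add: inst_def)
  from all_memD[OF this assms(4,5)] show ?thesis by (simp add: inst_def)
qed

lemma top_admissible:
  assumes "typed sg \<Gamma> T (Power Omega)"
  shows "entails sg \<Gamma> \<Delta> (\<^bold>\<top> \<^bold>\<in> admissible T)"
proof (rule admissibleI[OF assms])
  fix \<Delta>' assume "entails sg (Omega # \<Gamma>) \<Delta>' (Var 0 \<^bold>\<in> T\<up>)"
  then show "entails sg (Omega # \<Gamma>) \<Delta>' (c (\<^bold>\<top>\<up>) (Var 0) \<^bold>\<in> T\<up>)"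
    using iff_mem[OF c_top, of "Omega # \<Gamma>" "Var 0" "T\<up>"] assms by (auto intro: typed_wk)
qed simp

lemma dominantD:
  assumes "entails sg \<Gamma> \<Delta> (dominant T)" and "typed sg \<Gamma> u Omega" "typed sg \<Gamma> p Omega"
    and "entails sg \<Gamma> \<Delta> (u \<^bold>\<in> admissible T)" and "entails sg \<Gamma> \<Delta> (u \<^bold>\<longrightarrow> p \<^bold>\<in> T)"
  shows "entails sg \<Gamma> \<Delta> (c u p \<^bold>\<in> T)"
proof -
  have "entails sg \<Gamma> \<Delta> (\<^bold>\<forall>[Omega]. (Var 0 \<^bold>\<in> (admissible T)\<up> \<^bold>\<longrightarrow>
      (\<^bold>\<forall>[Omega]. ((Var 1 \<^bold>\<longrightarrow> Var 0 \<^bold>\<in> T\<up>\<up>) \<^bold>\<longrightarrow> c (Var 1) (Var 0) \<^bold>\<in> T\<up>\<up>))))"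
    using assms(1) by (simp add: dominant_def)
  from all_memD[OF this assms(2,4)]
  have "entails sg \<Gamma> \<Delta> (\<^bold>\<forall>[Omega]. ((u\<up> \<^bold>\<longrightarrow> Var 0 \<^bold>\<in> T\<up>) \<^bold>\<longrightarrow> c (u\<up>) (Var 0) \<^bold>\<in> T\<up>))"
    by (simp add: inst_def)
  from entails.forallE[OF this assms(3)]
  have "entails sg \<Gamma> \<Delta> ((u \<^bold>\<longrightarrow> p \<^bold>\<in> T) \<^bold>\<longrightarrow> c u p \<^bold>\<in> T)" by (simp add: inst_def)
  then show ?thesis by (rule entails.implE[OF _ assms(5)])
qed

lemma dominantI:
  assumes "typed sg \<Gamma> T (Power Omega)"
    and "\<And>\<Delta>'. (wk ` wk ` \<Delta>) \<subseteq> \<Delta>' \<Longrightarrow>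
      entails sg (Omega # Omega # \<Gamma>) \<Delta>' (Var 1 \<^bold>\<in> admissible (T\<up>\<up>)) \<Longrightarrow>
      entails sg (Omega # Omega # \<Gamma>) \<Delta>' (Var 1 \<^bold>\<longrightarrow> Var 0 \<^bold>\<in> T\<up>\<up>) \<Longrightarrow>
      entails sg (Omega # Omega # \<Gamma>) \<Delta>' (c (Var 1) (Var 0) \<^bold>\<in> T\<up>\<up>)"
  shows "entails sg \<Gamma> \<Delta> (dominant T)"
  unfolding dominant_def ren_admissible[symmetric]
proof (intro all_memI entails.forallI implI')
  fix \<Delta>' \<Delta>'' assume 1: "wk ` \<Delta> \<subseteq> \<Delta>'" "entails sg (Omega # \<Gamma>) \<Delta>' (Var 0 \<^bold>\<in> (admissible T)\<up>)"
    and 2: "wk ` \<Delta>' \<subseteq> \<Delta>''"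
      "entails sg (Omega # Omega # \<Gamma>) \<Delta>'' (Var 1 \<^bold>\<longrightarrow> Var 0 \<^bold>\<in> T\<up>\<up>)"
  show "entails sg (Omega # Omega # \<Gamma>) \<Delta>'' (c (Var 1) (Var 0) \<^bold>\<in> T\<up>\<up>)"
    by (rule assms(2)) (use 1 2 entails_wk[OF 1(2) 2(1), of Omega] in auto)
qed (use assms(1) in \<open>auto intro!: exI typed_wk\<close>)


section \<open>Classification from dominance\<close>

text \<open>
  At \<open>x \<in> X\<close> write \<open>u\<close> for \<open>x \<in> U\<close> and \<open>p\<close> for \<open>x \<in> B\<close>, where \<open>B\<close> is the test subset of \<open>U\<close> to be
  extended. Then \<open>u\<close> is admissible and implies \<open>p \<in> T\<close>, so dominance makes \<open>c u p\<close> a test value: this is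
  the truth value of the extension at \<open>x\<close>. It meets \<open>U\<close> in \<open>B\<close> because \<open>u \<and> c u p\<close> is \<open>u \<and> p\<close>, which
  is \<open>p\<close> as \<open>B \<subseteq> U\<close>.
\<close>

lemma dominant_subspace:
  assumes T: "typed sg \<Gamma> T (Power Omega)" and U: "typed sg \<Gamma> U (Power A)"
    and X: "typed sg \<Gamma> X (Power A)"
    and dom: "entails sg \<Gamma> \<Delta> (dominant T)"
    and sub: "entails sg \<Gamma> \<Delta> (subset_of A U X)"
    and val: "entails sg \<Gamma> \<Delta> (values_in (admissible T) A U X)"
  shows "entails sg \<Gamma> \<Delta> (subspace T A U X)"
proof (rule subspaceI[OF T U X _ sub])
  \<comment> \<open>The extension of \<open>B\<close>; the variable of index 0 in \<open>?\<Gamma>\<close>, hence 1 inside \<open>?C\<close>, is \<open>B\<close>.\<close>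
  let ?C = "Compr A (Var 0 \<^bold>\<in> X\<up>\<up> \<^bold>\<and> c (Var 0 \<^bold>\<in> U\<up>\<up>) (Var 0 \<^bold>\<in> Var 1))"
  let ?\<Gamma> = "Power A # \<Gamma>"
  note [intro!] = typed_wk T U X exI
  show C: "typed sg ?\<Gamma> ?C (Power A)" by auto
  have mem_C: "entails sg (A # ?\<Gamma>) \<Delta>' (Var 0 \<^bold>\<in> ?C\<up>) \<longleftrightarrow>
      entails sg (A # ?\<Gamma>) \<Delta>' (Var 0 \<^bold>\<in> X\<up>\<up>) \<and>
      entails sg (A # ?\<Gamma>) \<Delta>' (c (Var 0 \<^bold>\<in> U\<up>\<up>) (Var 0 \<^bold>\<in> Var 1))" for \<Delta>'
    by (simp, subst entails_mem_Compr) (auto simp: inst_def entails_conj)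
  have [intro!]: "typed sg (A # ?\<Gamma>) (?C\<up>) (Power A)" using C by (rule typed_wk)
  fix \<Delta>1 assume \<Delta>1: "wk ` \<Delta> \<subseteq> \<Delta>1"
    and B: "entails sg ?\<Gamma> \<Delta>1 (test_subset (T\<up>) A (Var 0) (U\<up>))"
  then have B_sub: "entails sg ?\<Gamma> \<Delta>1 (subset_of A (Var 0) (U\<up>))"
    and B_val: "entails sg ?\<Gamma> \<Delta>1 (values_in (T\<up>) A (Var 0) (U\<up>))"
    by (simp_all add: test_subset_def entails_conj)
  have B_sub': "entails sg (A # ?\<Gamma>) \<Delta>2 (Var 0 \<^bold>\<in> U\<up>\<up>)"
    if "wk ` \<Delta>1 \<subseteq> \<Delta>2" "entails sg (A # ?\<Gamma>) \<Delta>2 (Var 0 \<^bold>\<in> Var 1)" for \<Delta>2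
    using subset_ofD[OF entails_wk[OF B_sub that(1), simplified]] that(2) by simp
  have sub': "entails sg (A # ?\<Gamma>) \<Delta>2 (Var 0 \<^bold>\<in> X\<up>\<up>)"
    if "wk ` \<Delta>1 \<subseteq> \<Delta>2" "entails sg (A # ?\<Gamma>) \<Delta>2 (Var 0 \<^bold>\<in> U\<up>\<up>)" for \<Delta>2
    using subset_ofD[OF entails_wk[OF entails_wk[OF sub \<Delta>1] that(1), simplified]] that(2) by simp
  have conj: "entails sg (A # ?\<Gamma>) \<Delta>2 ((Var 0 \<^bold>\<in> U\<up>\<up>) \<^bold>\<and> c (Var 0 \<^bold>\<in> U\<up>\<up>) (Var 0 \<^bold>\<in> Var 1) \<^bold>\<longleftrightarrow>
    (Var 0 \<^bold>\<in> U\<up>\<up>) \<^bold>\<and> (Var 0 \<^bold>\<in> Var 1))" for \<Delta>2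
    by (rule conj_c) auto
  show "entails sg ?\<Gamma> \<Delta>1 (test_subset (T\<up>) A ?C (X\<up>)) \<and>
      entails sg ?\<Gamma> \<Delta>1 (Var 0 \<^bold>= intersection A (U\<up>) ?C)"
    unfolding test_subset_def entails_conj
  proof (intro HOL.conjI)
    show "entails sg ?\<Gamma> \<Delta>1 (subset_of A ?C (X\<up>))"
      by (rule subset_ofI[OF C]) (simp only: mem_C)
    show "entails sg ?\<Gamma> \<Delta>1 (values_in (T\<up>) A ?C (X\<up>))"
    proof (rule values_inI)
      fix \<Delta>2 assume \<Delta>2: "wk ` \<Delta>1 \<subseteq> \<Delta>2" and x: "entails sg (A # ?\<Gamma>) \<Delta>2 (Var 0 \<^bold>\<in> X\<up>\<up>)"
      have eq: "entails sg (A # ?\<Gamma>) \<Delta>2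
          ((Var 0 \<^bold>\<in> ?C\<up>) \<^bold>\<longleftrightarrow> c (Var 0 \<^bold>\<in> U\<up>\<up>) (Var 0 \<^bold>\<in> Var 1))"
      proof (rule iffI')
        fix \<Delta>3 assume "\<Delta>2 \<subseteq> \<Delta>3" "entails sg (A # ?\<Gamma>) \<Delta>3 (c (Var 0 \<^bold>\<in> U\<up>\<up>) (Var 0 \<^bold>\<in> Var 1))"
        then show "entails sg (A # ?\<Gamma>) \<Delta>3 (Var 0 \<^bold>\<in> ?C\<up>)"
          unfolding mem_C using entails_mono[OF x] by blast
      next
        fix \<Delta>3 assume "entails sg (A # ?\<Gamma>) \<Delta>3 (Var 0 \<^bold>\<in> ?C\<up>)"
        then show "entails sg (A # ?\<Gamma>) \<Delta>3 (c (Var 0 \<^bold>\<in> U\<up>\<up>) (Var 0 \<^bold>\<in> Var 1))"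
          unfolding mem_C by blast
      qed auto
      have "entails sg (A # ?\<Gamma>) \<Delta>2 (c (Var 0 \<^bold>\<in> U\<up>\<up>) (Var 0 \<^bold>\<in> Var 1) \<^bold>\<in> T\<up>\<up>)"
      proof (rule dominantD)
        show "entails sg (A # ?\<Gamma>) \<Delta>2 (dominant (T\<up>\<up>))"
          using entails_wk[OF entails_wk[OF dom \<Delta>1] \<Delta>2] by simp
        show "entails sg (A # ?\<Gamma>) \<Delta>2 ((Var 0 \<^bold>\<in> U\<up>\<up>) \<^bold>\<in> admissible (T\<up>\<up>))"
          using values_inD[OF entails_wk[OF entails_wk[OF val \<Delta>1] \<Delta>2, simplified]] x by simp
        show "entails sg (A # ?\<Gamma>) \<Delta>2 (Var 0 \<^bold>\<in> U\<up>\<up> \<^bold>\<longrightarrow> (Var 0 \<^bold>\<in> Var 1) \<^bold>\<in> T\<up>\<up>)"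
        proof (rule implI')
          fix \<Delta>3 assume "\<Delta>2 \<subseteq> \<Delta>3" "entails sg (A # ?\<Gamma>) \<Delta>3 (Var 0 \<^bold>\<in> U\<up>\<up>)"
          then show "entails sg (A # ?\<Gamma>) \<Delta>3 ((Var 0 \<^bold>\<in> Var 1) \<^bold>\<in> T\<up>\<up>)"
            using values_inD[OF entails_wk[OF B_val, of \<Delta>3, simplified]] \<Delta>2 by auto
        qed auto
      qed auto
      from iff_mem[OF eq _ this]
      show "entails sg (A # ?\<Gamma>) \<Delta>2 ((Var 0 \<^bold>\<in> ?C\<up>) \<^bold>\<in> T\<up>\<up>)" by auto
    qed auto
    show "entails sg ?\<Gamma> \<Delta>1 (Var 0 \<^bold>= intersection A (U\<up>) ?C)"
    proof (rule set_extI)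
      fix \<Delta>2 assume \<Delta>2: "wk ` \<Delta>1 \<subseteq> \<Delta>2"
        and b: "entails sg (A # ?\<Gamma>) \<Delta>2 (Var 0 \<^bold>\<in> (Var 0)\<up>)"
      then have u: "entails sg (A # ?\<Gamma>) \<Delta>2 (Var 0 \<^bold>\<in> U\<up>\<up>)" by (simp add: B_sub')
      moreover have "entails sg (A # ?\<Gamma>) \<Delta>2 (c (Var 0 \<^bold>\<in> U\<up>\<up>) (Var 0 \<^bold>\<in> Var 1))"
        using iffD2[OF conj[of \<Delta>2]] u b by (simp add: entails_conj)
      ultimately have "entails sg (A # ?\<Gamma>) \<Delta>2 (Var 0 \<^bold>\<in> ?C\<up>)"
        unfolding mem_C using sub'[OF \<Delta>2] by blast
      with u show "entails sg (A # ?\<Gamma>) \<Delta>2 (Var 0 \<^bold>\<in> (intersection A (U\<up>) ?C)\<up>)"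
        unfolding ren_intersection by (subst entails_mem_intersection) auto
    next
      fix \<Delta>2 assume \<Delta>2: "wk ` \<Delta>1 \<subseteq> \<Delta>2"
        and "entails sg (A # ?\<Gamma>) \<Delta>2 (Var 0 \<^bold>\<in> (intersection A (U\<up>) ?C)\<up>)"
      then have "entails sg (A # ?\<Gamma>) \<Delta>2 (Var 0 \<^bold>\<in> U\<up>\<up>)" "entails sg (A # ?\<Gamma>) \<Delta>2 (Var 0 \<^bold>\<in> ?C\<up>)"
        unfolding ren_intersection by (subst (asm) entails_mem_intersection; auto)+
      then show "entails sg (A # ?\<Gamma>) \<Delta>2 (Var 0 \<^bold>\<in> (Var 0)\<up>)"
        unfolding mem_C using iffD1[OF conj[of \<Delta>2]] by (simp add: entails_conj)
    qed auto
  qed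
qed

lemma dominant_strong_iff:
  assumes "typed sg \<Gamma> T (Power Omega)" "typed sg \<Gamma> U (Power A)" "typed sg \<Gamma> X (Power A)"
    and "entails sg \<Gamma> \<Delta> (dominant T)" and "entails sg \<Gamma> \<Delta> (subset_of A U X)"
  shows "entails sg \<Gamma> \<Delta> (strong T A U X) \<longleftrightarrow>
    entails sg \<Gamma> \<Delta> (values_in (admissible T) A U X)"
  using dominant_subspace[OF assms] assms(5) by (auto simp: entails_strong)

lemma ren_class_values [simp]:
  "ren (class_values strong T) \<rho> = class_values strong (ren T \<rho>)"
  by (simp add: class_values_def)

lemma typed_class_values [intro!]:
  "typed sg \<Gamma> T (Power Omega) \<Longrightarrow> typed sg \<Gamma> (class_values strong T) (Power Omega)"
  by (auto simp: class_values_def intro!: typed_wk)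

lemma singleton_values_in:
  assumes "typed sg \<Gamma> S (Power Omega)" "typed sg \<Gamma> u Omega"
  shows "entails sg \<Gamma> \<Delta> (values_in S One (Compr One (u\<up>)) (Compr One \<^bold>\<top>)) \<longleftrightarrow>
    entails sg \<Gamma> \<Delta> (u \<^bold>\<in> S)"
proof -
  note [intro!] = typed_wk exI assms
  have iff: "entails sg \<Gamma>' \<Delta>' (a \<^bold>\<in> Compr One (v\<up>) \<^bold>\<longleftrightarrow> v)"
    if "typed sg \<Gamma>' v Omega" "typed sg \<Gamma>' a One" for \<Gamma>' \<Delta>' a v
    using entails.compr[OF typed_wk[OF that(1)] that(2), of \<Delta>'] by (simp add: inst_def)
  show ?thesis
  proof
    assume *: "entails sg \<Gamma> \<Delta> (values_in S One (Compr One (u\<up>)) (Compr One \<^bold>\<top>))"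
    have "entails sg \<Gamma> \<Delta> ((Star \<^bold>\<in> Compr One (u\<up>)) \<^bold>\<in> S)"
      by (rule values_inD[OF *])
        (auto simp: entails_mem_Compr inst_def intro: entails.truI)
    then show "entails sg \<Gamma> \<Delta> (u \<^bold>\<in> S)"
      by (rule iff_mem[OF iff_sym[OF iff] assms(1), rotated 2]) auto
  next
    assume u: "entails sg \<Gamma> \<Delta> (u \<^bold>\<in> S)"
    show "entails sg \<Gamma> \<Delta> (values_in S One (Compr One (u\<up>)) (Compr One \<^bold>\<top>))"
    proof (rule values_inI)
      fix \<Delta>' assume "wk ` \<Delta> \<subseteq> \<Delta>'"
      from entails_wk[OF u this]
      have "entails sg (One # \<Gamma>) \<Delta>' (u\<up> \<^bold>\<in> S\<up>)" by simp
      then have "entails sg (One # \<Gamma>) \<Delta>' ((Var 0 \<^bold>\<in> Compr One (u\<up>\<up>)) \<^bold>\<in> S\<up>)"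
        by (rule iff_mem[OF iff, rotated 3]) auto
      then show "entails sg (One # \<Gamma>) \<Delta>' ((Var 0 \<^bold>\<in> (Compr One (u\<up>))\<up>) \<^bold>\<in> S\<up>)" by simp
    qed auto
  qed
qed

text \<open>
  Under dominance, a subset \<open>{* | u}\<close> of the singleton is strong if and only if it has admissible truth
  values, and its only truth value is \<open>u\<close>.
\<close>

lemma dominant_class_values:
  assumes T: "typed sg \<Gamma> T (Power Omega)" and dom: "entails sg \<Gamma> \<Delta> (dominant T)"
  shows "entails sg \<Gamma> \<Delta> (class_values strong T \<^bold>= admissible T)"
proof -
  note [intro!] = typed_wk exI T
  have *: "entails sg (Omega # \<Gamma>) \<Delta>' (Var 0 \<^bold>\<in> (class_values strong T)\<up>) \<longleftrightarrow>
      entails sg (Omega # \<Gamma>) \<Delta>' (Var 0 \<^bold>\<in> (admissible T)\<up>)" if \<Delta>': "wk ` \<Delta> \<subseteq> \<Delta>'" for \<Delta>'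
  proof -
    have "entails sg (Omega # \<Gamma>) \<Delta>' (Var 0 \<^bold>\<in> (class_values strong T)\<up>) \<longleftrightarrow>
        entails sg (Omega # \<Gamma>) \<Delta>' (strong (T\<up>) One (Compr One ((Var 0)\<up>)) (Compr One \<^bold>\<top>))"
      unfolding ren_class_values unfolding class_values_def
      by (subst entails_mem_Compr) (auto simp: inst_def)
    also have "\<dots> \<longleftrightarrow> entails sg (Omega # \<Gamma>) \<Delta>'
        (values_in (admissible (T\<up>)) One (Compr One ((Var 0)\<up>)) (Compr One \<^bold>\<top>))"
    proof (rule dominant_strong_iff)
      show "entails sg (Omega # \<Gamma>) \<Delta>' (dominant (T\<up>))" using entails_wk[OF dom \<Delta>'] by simp
      show "entails sg (Omega # \<Gamma>) \<Delta>' (subset_of One (Compr One ((Var 0)\<up>)) (Compr One \<^bold>\<top>))"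
        by (rule subset_ofI) (auto simp: entails_mem_Compr inst_def intro: entails.truI)
    qed auto
    also have "\<dots> \<longleftrightarrow> entails sg (Omega # \<Gamma>) \<Delta>' (Var 0 \<^bold>\<in> admissible (T\<up>))"
      by (rule singleton_values_in) auto
    finally show ?thesis by simp
  qed
  show ?thesis by (rule set_extI[where A = Omega]) (simp_all only: *, auto)
qed

lemma values_in_cong:
  assumes "entails sg \<Gamma> \<Delta> (S \<^bold>= S')" "typed sg \<Gamma> S (Power Omega)" "typed sg \<Gamma> S' (Power Omega)"
    and "typed sg \<Gamma> U (Power A)" "typed sg \<Gamma> X (Power A)"
    and "entails sg \<Gamma> \<Delta> (values_in S A U X)"
  shows "entails sg \<Gamma> \<Delta> (values_in S' A U X)"
proof -
  have "typed sg (Power Omega # \<Gamma>) (values_in (Var 0) A (U\<up>) (X\<up>)) Omega"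
    using assms(4,5) by (auto intro: typed_wk)
  from entails.subst[OF assms(1-3) this] show ?thesis using assms(6) by (simp add: inst_def)
qed

lemma classified_if_dominant:
  assumes T: "typed sg \<Gamma> T (Power Omega)" and dom: "entails sg \<Gamma> \<Delta> (dominant T)"
  shows "entails sg \<Gamma> \<Delta> (classified_by strong T (class_values strong T) A)"
  unfolding classified_by_def
proof (intro entails.forallI implI')
  note [intro!] = typed_wk exI T
  let ?\<Gamma> = "Power A # Power A # \<Gamma>"
  let ?cv = "class_values strong (T\<up>\<up>)" and ?ad = "admissible (T\<up>\<up>)"
  fix \<Delta>1 assume "wk ` wk ` \<Delta> \<subseteq> \<Delta>1" and sub: "entails sg ?\<Gamma> \<Delta>1 (subset_of A (Var 0) (Var 1))"
  then have dom': "entails sg ?\<Gamma> \<Delta>2 (dominant (T\<up>\<up>))" if "\<Delta>1 \<subseteq> \<Delta>2" for \<Delta>2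
    using entails_wk[OF entails_wk[OF dom order.refl], of \<Delta>2] that by simp
  have eq: "entails sg ?\<Gamma> \<Delta>2 (?cv \<^bold>= ?ad)" if "\<Delta>1 \<subseteq> \<Delta>2" for \<Delta>2
    by (rule dominant_class_values[OF _ dom'[OF that]]) auto
  have *: "entails sg ?\<Gamma> \<Delta>2 (strong (T\<up>\<up>) A (Var 0) (Var 1)) \<longleftrightarrow>
      entails sg ?\<Gamma> \<Delta>2 (values_in ?cv A (Var 0) (Var 1))" if "\<Delta>1 \<subseteq> \<Delta>2" for \<Delta>2
  proof -
    have "entails sg ?\<Gamma> \<Delta>2 (strong (T\<up>\<up>) A (Var 0) (Var 1)) \<longleftrightarrow>
        entails sg ?\<Gamma> \<Delta>2 (values_in ?ad A (Var 0) (Var 1))"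
      by (rule dominant_strong_iff[OF _ _ _ dom'[OF that] entails_mono[OF sub that]]) auto
    also have "\<dots> \<longleftrightarrow> entails sg ?\<Gamma> \<Delta>2 (values_in ?cv A (Var 0) (Var 1))"
      by (rule iffI; erule values_in_cong[rotated -1])
        (auto intro: eq[OF that] eq_sym[OF eq[OF that]])
    finally show ?thesis .
  qed
  show "entails sg ?\<Gamma> \<Delta>1 (strong (T\<up>\<up>) A (Var 0) (Var 1) \<^bold>\<longleftrightarrow>
      values_in ((class_values strong T)\<up>\<up>) A (Var 0) (Var 1))"
    unfolding ren_class_values by (rule iffI') (simp_all only: *, auto)
qed auto

section \<open>Continuity from classification\<close>

lemma classified_byD:
  assumes "entails sg \<Gamma> \<Delta> (classified_by strong T S A)"
    and "typed sg \<Gamma> U (Power A)" "typed sg \<Gamma> X (Power A)"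
    and "entails sg \<Gamma> \<Delta> (subset_of A U X)"
  shows "entails sg \<Gamma> \<Delta> (strong T A U X) \<longleftrightarrow> entails sg \<Gamma> \<Delta> (values_in S A U X)"
proof -
  have "entails sg \<Gamma> \<Delta> (\<^bold>\<forall>[Power A]. (subset_of A (Var 0) (X\<up>) \<^bold>\<longrightarrow>
      (strong (T\<up>) A (Var 0) (X\<up>) \<^bold>\<longleftrightarrow> values_in (S\<up>) A (Var 0) (X\<up>))))"
    using entails.forallE[OF assms(1)[unfolded classified_by_def] assms(3)]
    by (simp add: inst_def)
  from entails.forallE[OF this assms(2)]
  have "entails sg \<Gamma> \<Delta> (subset_of A U X \<^bold>\<longrightarrow> (strong T A U X \<^bold>\<longleftrightarrow> values_in S A U X))"
    by (simp add: inst_def)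
  from entails.implE[OF this assms(4)] show ?thesis by (blast intro: iffD1 iffD2)
qed

text \<open>
  Classification is applied twice: on \<open>Y\<close> it turns strength of \<open>V\<close> into a condition on truth values, which
  passes to the preimage pointwise, and on \<open>X\<close> it turns the condition back into strength.
\<close>

lemma strong_preimage:
  assumes T: "typed sg \<Gamma> T (Power Omega)" and S: "typed sg \<Gamma> S (Power Omega)"
    and X: "typed sg \<Gamma> X (Power A)" and Y: "typed sg \<Gamma> Y (Power B)"
    and F: "typed sg \<Gamma> F (Power (Prod A B))" and V: "typed sg \<Gamma> V (Power B)"
    and classified: "\<And>A. entails sg \<Gamma> \<Delta> (classified_by strong T S A)"
    and map: "entails sg \<Gamma> \<Delta> (is_map A B F X Y)"
    and strong: "entails sg \<Gamma> \<Delta> (strong T B V Y)"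
  shows "entails sg \<Gamma> \<Delta> (strong T A (preimage A B F V) X)"
proof -
  note [intro!] = typed_wk exI T S X Y F V
  have sub: "entails sg \<Gamma> \<Delta> (subset_of B V Y)" using strong by (simp add: entails_strong)
  have val: "entails sg \<Gamma> \<Delta> (values_in S B V Y)"
    using classified_byD[OF classified V Y sub] strong by blast
  have sub': "entails sg \<Gamma> \<Delta> (subset_of A (preimage A B F V) X)"
  proof (rule subset_ofI)
    fix \<Delta>1 assume \<Delta>1: "wk ` \<Delta> \<subseteq> \<Delta>1"
      and *: "entails sg (A # \<Gamma>) \<Delta>1 (Var 0 \<^bold>\<in> (preimage A B F V)\<up>)"
    show "entails sg (A # \<Gamma>) \<Delta>1 (Var 0 \<^bold>\<in> X\<up>)"
    proof (rule preimageE[OF *[simplified]])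
      fix \<Delta>2 assume "wk ` \<Delta>1 \<subseteq> \<Delta>2"
        and "entails sg (B # A # \<Gamma>) \<Delta>2 (Pr ((Var 0)\<up>) (Var 0) \<^bold>\<in> F\<up>\<up>)"
      then show "entails sg (B # A # \<Gamma>) \<Delta>2 ((Var 0 \<^bold>\<in> X\<up>)\<up>)"
        using is_map_domain[OF entails_wk[OF entails_wk[OF map \<Delta>1], simplified],
          of \<Delta>2 B A "Var 1" "Var 0"] by simp
    qed auto
  qed auto
  have "entails sg \<Gamma> \<Delta> (values_in S A (preimage A B F V) X)"
  proof (rule values_inI)
    fix \<Delta>1 assume \<Delta>1: "wk ` \<Delta> \<subseteq> \<Delta>1" and x: "entails sg (A # \<Gamma>) \<Delta>1 (Var 0 \<^bold>\<in> X\<up>)"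
    have map': "entails sg (A # \<Gamma>) \<Delta>1 (is_map A B (F\<up>) (X\<up>) (Y\<up>))"
      using entails_wk[OF map \<Delta>1] by simp
    show "entails sg (A # \<Gamma>) \<Delta>1 ((Var 0 \<^bold>\<in> (preimage A B F V)\<up>) \<^bold>\<in> S\<up>)"
    proof (rule is_map_valueE[OF map' _ x])
      fix \<Delta>2 assume \<Delta>2: "wk ` \<Delta>1 \<subseteq> \<Delta>2"
        and y: "entails sg (B # A # \<Gamma>) \<Delta>2 (Pr ((Var 0)\<up>) (Var 0) \<^bold>\<in> F\<up>\<up>)"
        and unique: "entails sg (B # A # \<Gamma>) \<Delta>2
          (\<^bold>\<forall>[B]. (Pr ((Var 0)\<up>\<up>) (Var 0) \<^bold>\<in> F\<up>\<up>\<up> \<^bold>\<longrightarrow> Var 0 \<^bold>= Var 1))"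
      have iff: "entails sg (B # A # \<Gamma>) \<Delta>2
          (Var 1 \<^bold>\<in> preimage A B (F\<up>\<up>) (V\<up>\<up>) \<^bold>\<longleftrightarrow> Var 0 \<^bold>\<in> V\<up>\<up>)"
        by (rule mem_preimage_iff) (use y unique in auto)
      have "entails sg (B # A # \<Gamma>) \<Delta>2 (Var 0 \<^bold>\<in> Y\<up>\<up>)"
        by (rule is_map_range[OF entails_wk[OF map' \<Delta>2, simplified] _ _ y]) auto
      then have "entails sg (B # A # \<Gamma>) \<Delta>2 ((Var 0 \<^bold>\<in> V\<up>\<up>) \<^bold>\<in> S\<up>\<up>)"
        using values_inD[OF entails_wk[OF entails_wk[OF val \<Delta>1] \<Delta>2, simplified]] by simp
      with iff show "entails sg (B # A # \<Gamma>) \<Delta>2 (((Var 0 \<^bold>\<in> (preimage A B F V)\<up>) \<^bold>\<in> S\<up>)\<up>)"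
        using iff_mem[OF iff, of "S\<up>\<up>"] by auto
    qed auto
  qed auto
  then show ?thesis using classified_byD[OF classified _ X sub'] by auto
qed

lemma ren_classified_by [simp]:
  "ren (classified_by strong T S A) \<rho> = classified_by strong (ren T \<rho>) (ren S \<rho>) A"
  by (simp add: classified_by_def)

lemma sub_classified_by [simp]:
  "sub (classified_by strong T S A) \<sigma> = classified_by strong (sub T \<sigma>) (sub S \<sigma>) A"
  by (simp add: classified_by_def)

lemma typed_classified_by [intro!]:
  "typed sg \<Gamma> T (Power Omega) \<Longrightarrow> typed sg \<Gamma> S (Power Omega) \<Longrightarrow>
    typed sg \<Gamma> (classified_by strong T S A) Omega"
  by (auto simp: classified_by_def intro!: typed_wk)

lemma ren_maps_continuous [simp]:
  "ren (maps_continuous strong T A B) \<rho> = maps_continuous strong (ren T \<rho>) A B"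
  by (simp add: maps_continuous_def numeral_2_eq_2 numeral_3_eq_3)

lemma typed_maps_continuous [intro!]:
  "typed sg \<Gamma> T (Power Omega) \<Longrightarrow> typed sg \<Gamma> (maps_continuous strong T A B) Omega"
  by (auto simp: maps_continuous_def numeral_2_eq_2 numeral_3_eq_3 intro!: typed_wk)

lemma maps_continuous_if_classified:
  assumes T: "typed sg \<Gamma> T (Power Omega)" and S: "typed sg \<Gamma> S (Power Omega)"
    and classified: "\<And>A. entails sg \<Gamma> \<Delta> (classified_by strong T S A)"
  shows "entails sg \<Gamma> \<Delta> (maps_continuous strong T A B)"
  unfolding maps_continuous_def
proof (intro entails.forallI implI')
  note [intro!] = typed_wk T S
  fix \<Delta>1 \<Delta>2 assume \<Delta>1: "wk ` wk ` wk ` \<Delta> \<subseteq> \<Delta>1" and \<Delta>2: "wk ` \<Delta>1 \<subseteq> \<Delta>2"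
    and map: "entails sg (Power (Prod A B) # Power B # Power A # \<Gamma>) \<Delta>1
      (is_map A B (Var 0) (Var 2) (Var 1))"
    and strong: "entails sg (Power B # Power (Prod A B) # Power B # Power A # \<Gamma>) \<Delta>2
      (strong (T\<up>\<up>\<up>\<up>) B (Var 0) (Var 2))"
  show "entails sg (Power B # Power (Prod A B) # Power B # Power A # \<Gamma>) \<Delta>2
      (strong (T\<up>\<up>\<up>\<up>) A (preimage A B (Var 1) (Var 0)) (Var 3))"
  proof (rule strong_preimage[OF _ _ _ _ _ _ _ _ strong])
    show "entails sg (Power B # Power (Prod A B) # Power B # Power A # \<Gamma>) \<Delta>2
        (classified_by strong (T\<up>\<up>\<up>\<up>) (S\<up>\<up>\<up>\<up>) C)" for C
      using entails_wk[OF entails_wk[OF entails_wk[OF entails_wk[OF classified[of C] order.refl]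
            order.refl] \<Delta>1] \<Delta>2] by simp
    show "entails sg (Power B # Power (Prod A B) # Power B # Power A # \<Gamma>) \<Delta>2
        (is_map A B (Var 1) (Var 3) (Var 2))"
      using entails_wk[OF map \<Delta>2] by (simp add: numeral_2_eq_2 numeral_3_eq_3)
  qed (auto simp: numeral_2_eq_2 numeral_3_eq_3)
qed (use T in \<open>auto simp: numeral_2_eq_2 numeral_3_eq_3 intro!: typed_wk\<close>)

lemma maps_continuousD:
  assumes "entails sg \<Gamma> \<Delta> (maps_continuous strong T A B)"
    and "typed sg \<Gamma> X (Power A)" "typed sg \<Gamma> Y (Power B)"
    and "typed sg \<Gamma> F (Power (Prod A B))" "typed sg \<Gamma> V (Power B)"
    and "entails sg \<Gamma> \<Delta> (is_map A B F X Y)" and "entails sg \<Gamma> \<Delta> (strong T B V Y)"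
  shows "entails sg \<Gamma> \<Delta> (strong T A (preimage A B F V) X)"
proof -
  have "entails sg \<Gamma> \<Delta> (\<^bold>\<forall>[Power B]. \<^bold>\<forall>[Power (Prod A B)].
        (is_map A B (Var 0) (X\<up>\<up>) (Var 1) \<^bold>\<longrightarrow>
         (\<^bold>\<forall>[Power B]. (strong (T\<up>\<up>\<up>) B (Var 0) (Var 2) \<^bold>\<longrightarrow>
            strong (T\<up>\<up>\<up>) A (preimage A B (Var 1) (Var 0)) (X\<up>\<up>\<up>)))))"
    using entails.forallE[OF assms(1)[unfolded maps_continuous_def] assms(2)]
    by (simp add: inst_def numeral_2_eq_2 numeral_3_eq_3)
  from entails.forallE[OF this assms(3)]
  have "entails sg \<Gamma> \<Delta> (\<^bold>\<forall>[Power (Prod A B)]. (is_map A B (Var 0) (X\<up>) (Y\<up>) \<^bold>\<longrightarrow>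
         (\<^bold>\<forall>[Power B]. (strong (T\<up>\<up>) B (Var 0) (Y\<up>\<up>) \<^bold>\<longrightarrow>
            strong (T\<up>\<up>) A (preimage A B (Var 1) (Var 0)) (X\<up>\<up>)))))"
    by (simp add: inst_def numeral_2_eq_2)
  from entails.forallE[OF this assms(4)]
  have "entails sg \<Gamma> \<Delta> (is_map A B F X Y \<^bold>\<longrightarrow>
         (\<^bold>\<forall>[Power B]. (strong (T\<up>) B (Var 0) (Y\<up>) \<^bold>\<longrightarrow>
            strong (T\<up>) A (preimage A B (F\<up>) (Var 0)) (X\<up>))))"
    by (simp add: inst_def)
  from entails.forallE[OF entails.implE[OF this assms(6)] assms(5)]
  have "entails sg \<Gamma> \<Delta> (strong T B V Y \<^bold>\<longrightarrow> strong T A (preimage A B F V) X)"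
    by (simp add: inst_def)
  then show ?thesis by (rule entails.implE[OF _ assms(7)])
qed

text \<open>
  Continuity does not mention the classifying set, so it may be derived for a generic one, \<open>Var 0\<close>.
\<close>

lemma maps_continuous_if_classified_by_some:
  assumes T: "typed sg \<Gamma> T (Power Omega)"
    and some: "classified_by_some sg \<Gamma> \<Delta> strong T"
  shows "entails sg \<Gamma> \<Delta> (maps_continuous strong T A B)"
proof (rule some[unfolded classified_by_some_def entails_some_def, rule_format])
  let ?\<Psi> = "range (classified_by strong (T\<up>) (Var 0))"
  have "entails sg (Power Omega # \<Gamma>) (wk ` \<Delta> \<union> ?\<Psi>) (maps_continuous strong (T\<up>) A B)"
    by (rule maps_continuous_if_classified[of _ _ "Var 0"])
      (use T in \<open>auto intro: typed_wk intro!: entails.hyp\<close>)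
  then show "entails sg (Power Omega # \<Gamma>) (wk ` \<Delta> \<union> ?\<Psi>) ((maps_continuous strong T A B)\<up>)"
    by simp
qed (use T in auto)

lemma classified_by_some_if_classified:
  assumes S: "typed sg \<Gamma> S (Power Omega)" and \<Delta>: "\<forall>\<phi>\<in>\<Delta>. typed sg \<Gamma> \<phi> Omega"
    and classified: "\<And>A. entails sg \<Gamma> \<Delta> (classified_by strong T S A)"
  shows "classified_by_some sg \<Gamma> \<Delta> strong T"
  unfolding classified_by_some_def entails_some_def
proof (intro allI impI)
  fix \<chi> assume "entails sg (Power Omega # \<Gamma>)
    (wk ` \<Delta> \<union> range (classified_by strong (T\<up>) (Var 0))) (\<chi>\<up>)"
  then have "entails sg \<Gamma> \<Delta> (sub (\<chi>\<up>) (case_nat S Var))"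
    by (rule entails_sub[OF _ typed_sub_inst[OF S]])
      (use \<Delta> classified in \<open>auto intro: entails.hyp\<close>)
  then show "entails sg \<Gamma> \<Delta> \<chi>" by simp
qed


section \<open>Dominance from continuity\<close>

text \<open>
  By propositional extensionality this is \<open>{\<top>}\<close>; the given form makes membership of \<open>u\<close> manifestly
  equivalent to \<open>u\<close>.
\<close>

definition true_part :: "('b, 'c) tm \<Rightarrow> ('b, 'c) tm" where
  "true_part T = Compr Omega (Var 0 \<^bold>\<and> Var 0 \<^bold>\<in> (admissible T)\<up>)"

lemma ren_true_part [simp]: "ren (true_part T) \<rho> = true_part (ren T \<rho>)"
  by (simp add: true_part_def)

lemma typed_true_part [intro!]:
  "typed sg \<Gamma> T (Power Omega) \<Longrightarrow> typed sg \<Gamma> (true_part T) (Power Omega)"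
  by (auto simp: true_part_def intro!: exI typed_wk)

lemma entails_mem_true_part:
  assumes "typed sg \<Gamma> T (Power Omega)" "typed sg \<Gamma> u Omega"
  shows "entails sg \<Gamma> \<Delta> (u \<^bold>\<in> true_part T) \<longleftrightarrow>
    entails sg \<Gamma> \<Delta> u \<and> entails sg \<Gamma> \<Delta> (u \<^bold>\<in> admissible T)"
  unfolding true_part_def
  by (subst entails_mem_Compr)
    (use assms in \<open>auto simp: inst_def entails_conj intro!: exI typed_wk\<close>)

text \<open>
  The truth value of \<open>u \<in> {\<top>}\<close> is \<open>u\<close>, hence admissible. A test subset \<open>B\<close> of \<open>{\<top>}\<close> is determined by the
  truth value of \<open>\<top> \<in> B\<close>, which is a test value because \<open>\<top>\<close> is admissible; the subset of the admissible
  truth values with this constant truth value extends \<open>B\<close>.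
\<close>

lemma true_part_strong:
  assumes T: "typed sg \<Gamma> T (Power Omega)"
  shows "entails sg \<Gamma> \<Delta> (strong T Omega (true_part T) (admissible T))"
  unfolding entails_strong
proof (intro HOL.conjI)
  note [intro!] = typed_wk exI T
  show sub: "entails sg \<Gamma> \<Delta> (subset_of Omega (true_part T) (admissible T))"
  proof (rule subset_ofI)
    fix \<Delta>1 assume "entails sg (Omega # \<Gamma>) \<Delta>1 (Var 0 \<^bold>\<in> (true_part T)\<up>)"
    then show "entails sg (Omega # \<Gamma>) \<Delta>1 (Var 0 \<^bold>\<in> (admissible T)\<up>)"
      unfolding ren_true_part by (subst (asm) entails_mem_true_part) auto
  qed auto
  show "entails sg \<Gamma> \<Delta> (values_in (admissible T) Omega (true_part T) (admissible T))"
  proof (rule values_inI)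
    fix \<Delta>1 assume x: "entails sg (Omega # \<Gamma>) \<Delta>1 (Var 0 \<^bold>\<in> (admissible T)\<up>)"
    have "entails sg (Omega # \<Gamma>) \<Delta>1 (Var 0 \<^bold>\<in> true_part (T\<up>) \<^bold>\<longleftrightarrow> Var 0)"
    proof (rule iffI')
      fix \<Delta>2 assume "entails sg (Omega # \<Gamma>) \<Delta>2 (Var 0 \<^bold>\<in> true_part (T\<up>))"
      then show "entails sg (Omega # \<Gamma>) \<Delta>2 (Var 0)"
        by (subst (asm) entails_mem_true_part) auto
    next
      fix \<Delta>2 assume "\<Delta>1 \<subseteq> \<Delta>2" "entails sg (Omega # \<Gamma>) \<Delta>2 (Var 0)"
      then show "entails sg (Omega # \<Gamma>) \<Delta>2 (Var 0 \<^bold>\<in> true_part (T\<up>))"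
        using entails_mono[OF x, of \<Delta>2] by (subst entails_mem_true_part) auto
    qed auto
    from iff_mem[OF this _ x]
    show "entails sg (Omega # \<Gamma>) \<Delta>1 ((Var 0 \<^bold>\<in> (true_part T)\<up>) \<^bold>\<in> (admissible T)\<up>)"
      by auto
  qed auto
  let ?\<Gamma> = "Power Omega # \<Gamma>"
  let ?C = "Compr Omega (Var 0 \<^bold>\<in> admissible (T\<up>\<up>) \<^bold>\<and> \<^bold>\<top> \<^bold>\<in> Var 1)"
  show "entails sg \<Gamma> \<Delta> (subspace T Omega (true_part T) (admissible T))"
  proof (rule subspaceI[OF _ _ _ _ sub])
    show C: "typed sg ?\<Gamma> ?C (Power Omega)" by auto
    have [intro!]: "typed sg (Omega # ?\<Gamma>) (?C\<up>) (Power Omega)" using C by (rule typed_wk)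
    have mem_C: "entails sg (Omega # ?\<Gamma>) \<Delta>' (Var 0 \<^bold>\<in> ?C\<up>) \<longleftrightarrow>
        entails sg (Omega # ?\<Gamma>) \<Delta>' (Var 0 \<^bold>\<in> admissible (T\<up>\<up>)) \<and>
        entails sg (Omega # ?\<Gamma>) \<Delta>' (\<^bold>\<top> \<^bold>\<in> Var 1)" for \<Delta>'
      by (simp, subst entails_mem_Compr) (auto simp: inst_def entails_conj)
    have top_iff: "entails sg (Omega # ?\<Gamma>) \<Delta>' (\<^bold>\<top> \<^bold>\<in> Var 1) \<longleftrightarrow>
        entails sg (Omega # ?\<Gamma>) \<Delta>' (Var 0 \<^bold>\<in> Var 1)"
      if "entails sg (Omega # ?\<Gamma>) \<Delta>' (Var 0)" for \<Delta>'
    proof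
      show "entails sg (Omega # ?\<Gamma>) \<Delta>' (Var 0 \<^bold>\<in> Var 1)"
        if "entails sg (Omega # ?\<Gamma>) \<Delta>' (\<^bold>\<top> \<^bold>\<in> Var 1)"
        by (rule eq_mem[OF eq_top[OF \<open>entails sg (Omega # ?\<Gamma>) \<Delta>' (Var 0)\<close>] _ _ _ that]) auto
      show "entails sg (Omega # ?\<Gamma>) \<Delta>' (\<^bold>\<top> \<^bold>\<in> Var 1)"
        if "entails sg (Omega # ?\<Gamma>) \<Delta>' (Var 0 \<^bold>\<in> Var 1)"
        by (rule eq_mem[OF eq_sym[OF eq_top[OF \<open>entails sg (Omega # ?\<Gamma>) \<Delta>' (Var 0)\<close>]] _ _ _ that])
          auto
    qed
    fix \<Delta>1 assume "wk ` \<Delta> \<subseteq> \<Delta>1"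
      and B: "entails sg ?\<Gamma> \<Delta>1 (test_subset (T\<up>) Omega (Var 0) ((true_part T)\<up>))"
    then have B_sub: "entails sg ?\<Gamma> \<Delta>1 (subset_of Omega (Var 0) (true_part (T\<up>)))"
      and B_val: "entails sg ?\<Gamma> \<Delta>1 (values_in (T\<up>) Omega (Var 0) (true_part (T\<up>)))"
      by (simp_all add: test_subset_def entails_conj)
    show "entails sg ?\<Gamma> \<Delta>1 (test_subset (T\<up>) Omega ?C ((admissible T)\<up>)) \<and>
        entails sg ?\<Gamma> \<Delta>1 (Var 0 \<^bold>= intersection Omega ((true_part T)\<up>) ?C)"
      unfolding test_subset_def entails_conj ren_admissible ren_true_part
    proof (intro HOL.conjI)
      show "entails sg ?\<Gamma> \<Delta>1 (subset_of Omega ?C (admissible (T\<up>)))"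
        by (rule subset_ofI[OF C]) (simp only: mem_C ren_admissible)
      show "entails sg ?\<Gamma> \<Delta>1 (values_in (T\<up>) Omega ?C (admissible (T\<up>)))"
      proof (rule values_inI)
        fix \<Delta>2 assume \<Delta>2: "wk ` \<Delta>1 \<subseteq> \<Delta>2"
          and x: "entails sg (Omega # ?\<Gamma>) \<Delta>2 (Var 0 \<^bold>\<in> (admissible (T\<up>))\<up>)"
        have "entails sg (Omega # ?\<Gamma>) \<Delta>2 (\<^bold>\<top> \<^bold>\<in> true_part (T\<up>\<up>))"
          by (subst entails_mem_true_part) (auto intro: top_admissible entails.truI)
        then have top: "entails sg (Omega # ?\<Gamma>) \<Delta>2 ((\<^bold>\<top> \<^bold>\<in> Var 1) \<^bold>\<in> T\<up>\<up>)"
          using values_inD[OF entails_wk[OF B_val \<Delta>2, simplified]] by simp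
        have "entails sg (Omega # ?\<Gamma>) \<Delta>2 (Var 0 \<^bold>\<in> ?C\<up> \<^bold>\<longleftrightarrow> \<^bold>\<top> \<^bold>\<in> Var 1)"
        proof (rule iffI')
          fix \<Delta>3 assume "\<Delta>2 \<subseteq> \<Delta>3" "entails sg (Omega # ?\<Gamma>) \<Delta>3 (\<^bold>\<top> \<^bold>\<in> Var 1)"
          then show "entails sg (Omega # ?\<Gamma>) \<Delta>3 (Var 0 \<^bold>\<in> ?C\<up>)"
            unfolding mem_C using entails_mono[OF x] by simp
        next
          fix \<Delta>3 assume "entails sg (Omega # ?\<Gamma>) \<Delta>3 (Var 0 \<^bold>\<in> ?C\<up>)"
          then show "entails sg (Omega # ?\<Gamma>) \<Delta>3 (\<^bold>\<top> \<^bold>\<in> Var 1)" unfolding mem_C by blast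
        qed auto
        from iff_mem[OF this _ top]
        show "entails sg (Omega # ?\<Gamma>) \<Delta>2 ((Var 0 \<^bold>\<in> ?C\<up>) \<^bold>\<in> T\<up>\<up>)" by auto
      qed auto
      show "entails sg ?\<Gamma> \<Delta>1 (Var 0 \<^bold>= intersection Omega (true_part (T\<up>)) ?C)"
      proof (rule set_extI)
        fix \<Delta>2 assume \<Delta>2: "wk ` \<Delta>1 \<subseteq> \<Delta>2"
          and b: "entails sg (Omega # ?\<Gamma>) \<Delta>2 (Var 0 \<^bold>\<in> (Var 0)\<up>)"
        have v: "entails sg (Omega # ?\<Gamma>) \<Delta>2 (Var 0 \<^bold>\<in> true_part (T\<up>\<up>))"
          using subset_ofD[OF entails_wk[OF B_sub \<Delta>2, simplified]] b by simp
        then have "entails sg (Omega # ?\<Gamma>) \<Delta>2 (Var 0)"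
          "entails sg (Omega # ?\<Gamma>) \<Delta>2 (Var 0 \<^bold>\<in> admissible (T\<up>\<up>))"
          by (subst (asm) entails_mem_true_part; auto)+
        then have "entails sg (Omega # ?\<Gamma>) \<Delta>2 (Var 0 \<^bold>\<in> ?C\<up>)"
          unfolding mem_C using top_iff b by simp
        with v show "entails sg (Omega # ?\<Gamma>) \<Delta>2
            (Var 0 \<^bold>\<in> (intersection Omega (true_part (T\<up>)) ?C)\<up>)"
          unfolding ren_intersection by (subst entails_mem_intersection) auto
      next
        fix \<Delta>2 assume "entails sg (Omega # ?\<Gamma>) \<Delta>2
            (Var 0 \<^bold>\<in> (intersection Omega (true_part (T\<up>)) ?C)\<up>)"
        then have "entails sg (Omega # ?\<Gamma>) \<Delta>2 (Var 0 \<^bold>\<in> true_part (T\<up>\<up>))"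
          "entails sg (Omega # ?\<Gamma>) \<Delta>2 (Var 0 \<^bold>\<in> ?C\<up>)"
          unfolding ren_intersection by (subst (asm) entails_mem_intersection; auto)+
        moreover from this(1) have "entails sg (Omega # ?\<Gamma>) \<Delta>2 (Var 0)"
          by (subst (asm) entails_mem_true_part) auto
        ultimately show "entails sg (Omega # ?\<Gamma>) \<Delta>2 (Var 0 \<^bold>\<in> (Var 0)\<up>)"
          unfolding mem_C using top_iff by simp
      qed auto
    qed
  qed auto
qed


definition graph_of_const :: "('b, 'c) tm \<Rightarrow> ('b, 'c) tm" where
  "graph_of_const u = Compr (Prod One Omega) (Snd (Var 0) \<^bold>= u\<up>)"

lemma ren_graph_of_const [simp]: "ren (graph_of_const u) \<rho> = graph_of_const (ren u \<rho>)"
  by (simp add: graph_of_const_def)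

lemma typed_graph_of_const [intro!]:
  "typed sg \<Gamma> u Omega \<Longrightarrow> typed sg \<Gamma> (graph_of_const u) (Power (Prod One Omega))"
  by (auto simp: graph_of_const_def intro!: exI[of _ Omega] typed_wk
      intro: typed.Snd[of _ _ _ One])

lemma mem_graph_of_const:
  assumes u: "typed sg \<Gamma> u Omega" and a: "typed sg \<Gamma> a One" and v: "typed sg \<Gamma> v Omega"
  shows "entails sg \<Gamma> \<Delta> (Pr a v \<^bold>\<in> graph_of_const u) \<longleftrightarrow> entails sg \<Gamma> \<Delta> (v \<^bold>= u)"
proof -
  have snd: "typed sg \<Gamma> (Snd (Pr a v)) Omega" using a v by (auto intro: typed.Snd)
  have eq: "entails sg \<Gamma> \<Delta> (Snd (Pr a v) \<^bold>= v)" by (rule entails.snd[OF a v])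
  have "entails sg \<Gamma> \<Delta> (Pr a v \<^bold>\<in> graph_of_const u) \<longleftrightarrow> entails sg \<Gamma> \<Delta> (Snd (Pr a v) \<^bold>= u)"
    unfolding graph_of_const_def
    by (subst entails_mem_Compr)
      (use assms in \<open>auto simp: inst_def intro!: exI[of _ Omega] typed_wk
        intro: typed.Snd[of _ _ _ One]\<close>)
  also have "\<dots> \<longleftrightarrow> entails sg \<Gamma> \<Delta> (v \<^bold>= u)"
  proof -
    have \<phi>: "typed sg (Omega # \<Gamma>) (Var 0 \<^bold>= u\<up>) Omega" using u by (auto intro!: exI typed_wk)
    show ?thesis
      using entails.subst[OF eq snd v \<phi>] entails.subst[OF eq_sym[OF eq snd v] v snd \<phi>]
      by (auto simp: inst_def)
  qed
  finally show ?thesis .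
qed

lemma graph_of_const_is_map:
  assumes T: "typed sg \<Gamma> T (Power Omega)" and u: "typed sg \<Gamma> u Omega"
    and adm: "entails sg \<Gamma> \<Delta> (u \<^bold>\<in> admissible T)"
  shows "entails sg \<Gamma> \<Delta>
    (is_map One Omega (graph_of_const u) (Compr One \<^bold>\<top>) (admissible T))"
proof (rule is_mapI[where b = "u\<up>"])
  note [intro!] = typed_wk exI T u
  show "typed sg \<Gamma> (graph_of_const u) (Power (Prod One Omega))"
    "typed sg \<Gamma> (Compr One \<^bold>\<top>) (Power One)" "typed sg (One # \<Gamma>) (u\<up>) Omega" by auto
  show "entails sg (One # \<Gamma>) \<Delta>' (Pr (Var 0) (u\<up>) \<^bold>\<in> (graph_of_const u)\<up>)" for \<Delta>'
    unfolding ren_graph_of_const by (subst mem_graph_of_const) (auto intro: entails.refl)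
  fix \<Delta>' assume \<Delta>': "wk ` wk ` \<Delta> \<subseteq> \<Delta>'"
    and "entails sg (Omega # One # \<Gamma>) \<Delta>' (Pr (Var 1) (Var 0) \<^bold>\<in> (graph_of_const u)\<up>\<up>)"
  then have eq: "entails sg (Omega # One # \<Gamma>) \<Delta>' (Var 0 \<^bold>= u\<up>\<up>)"
    unfolding ren_graph_of_const by (subst (asm) mem_graph_of_const) auto
  then show "entails sg (Omega # One # \<Gamma>) \<Delta>' (Var 0 \<^bold>= u\<up>\<up>)" .
  have "entails sg (Omega # One # \<Gamma>) \<Delta>' (u\<up>\<up> \<^bold>\<in> admissible (T\<up>\<up>))"
    using entails_wk[OF entails_wk[OF adm order.refl] \<Delta>'] by simp
  from eq_mem[OF eq_sym[OF eq] _ _ _ this]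
  have "entails sg (Omega # One # \<Gamma>) \<Delta>' (Var 0 \<^bold>\<in> admissible (T\<up>\<up>))" by auto
  moreover have "entails sg (Omega # One # \<Gamma>) \<Delta>' (Var 1 \<^bold>\<in> Compr One \<^bold>\<top>)"
    by (subst entails_mem_Compr) (auto simp: inst_def intro: entails.truI)
  ultimately show "entails sg (Omega # One # \<Gamma>) \<Delta>' (Var 1 \<^bold>\<in> (Compr One \<^bold>\<top>)\<up>\<up>) \<and>
      entails sg (Omega # One # \<Gamma>) \<Delta>' (Var 0 \<^bold>\<in> (admissible T)\<up>\<up>)" by simp
qed

lemma mem_preimage_true_part:
  assumes T: "typed sg \<Gamma> T (Power Omega)" and u: "typed sg \<Gamma> u Omega"
    and a: "typed sg \<Gamma> a One"
    and adm: "entails sg \<Gamma> \<Delta> (u \<^bold>\<in> admissible T)"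
  shows "entails sg \<Gamma> \<Delta>
    (a \<^bold>\<in> preimage One Omega (graph_of_const u) (true_part T) \<^bold>\<longleftrightarrow> u)"
proof -
  note [intro!] = typed_wk exI T u a
  have "entails sg \<Gamma> \<Delta>
      (a \<^bold>\<in> preimage One Omega (graph_of_const u) (true_part T) \<^bold>\<longleftrightarrow> u \<^bold>\<in> true_part T)"
  proof (rule mem_preimage_iff)
    show "entails sg \<Gamma> \<Delta> (Pr a u \<^bold>\<in> graph_of_const u)"
      by (subst mem_graph_of_const) (auto intro: entails.refl)
    show "entails sg \<Gamma> \<Delta>
        (\<^bold>\<forall>[Omega]. (Pr (a\<up>) (Var 0) \<^bold>\<in> (graph_of_const u)\<up> \<^bold>\<longrightarrow> Var 0 \<^bold>= u\<up>))"
      unfolding ren_graph_of_const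
      by (intro entails.forallI implI', auto, subst (asm) mem_graph_of_const, auto)
  qed auto
  note P_iff = entails_mono[OF this]
  have V_iff: "entails sg \<Gamma> \<Delta>' (u \<^bold>\<in> true_part T) \<longleftrightarrow> entails sg \<Gamma> \<Delta>' u" if "\<Delta> \<subseteq> \<Delta>'" for \<Delta>'
    using entails_mono[OF adm that] by (subst entails_mem_true_part) auto
  show ?thesis
    by (rule iffI') (use iffD1[OF P_iff] iffD2[OF P_iff] V_iff in auto)
qed

text \<open>
  The preimage \<open>P\<close> of \<open>{\<top>}\<close> under the map with value \<open>u\<close> has truth value \<open>u\<close>, and it is a subspace of the
  singleton. Extending its test subset with truth value \<open>u \<and> p\<close> yields a test value \<open>t\<close> such that
  \<open>u \<and> p\<close> is equivalent to \<open>u \<and> t\<close>; hence \<open>c u p\<close> is equivalent to \<open>c u t\<close>, which is a test value as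
  \<open>u\<close> is admissible.
\<close>

lemma dominant_instance:
  assumes T: "typed sg \<Gamma> T (Power Omega)" and u: "typed sg \<Gamma> u Omega" and p: "typed sg \<Gamma> p Omega"
    and cont: "entails sg \<Gamma> \<Delta> (maps_continuous strong T One Omega)"
    and adm: "entails sg \<Gamma> \<Delta> (u \<^bold>\<in> admissible T)"
    and up: "entails sg \<Gamma> \<Delta> (u \<^bold>\<longrightarrow> p \<^bold>\<in> T)"
  shows "entails sg \<Gamma> \<Delta> (c u p \<^bold>\<in> T)"
proof -
  note [intro!] = typed_wk exI T u p
  define P where "P = preimage One Omega (graph_of_const u) (true_part T)"
  have P [intro!]: "typed sg \<Gamma> P (Power One)" by (auto simp: P_def)
  have "entails sg \<Gamma> \<Delta> (strong T One P (Compr One \<^bold>\<top>))"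
    unfolding P_def
    by (rule maps_continuousD[OF cont _ _ _ _ graph_of_const_is_map[OF T u adm] true_part_strong[OF T]])
      auto
  then have subsp: "entails sg \<Gamma> \<Delta> (subspace T One P (Compr One \<^bold>\<top>))"
    by (simp add: entails_strong)
  have mem_P: "entails sg (D # \<Gamma>) \<Delta>' (a \<^bold>\<in> P\<up>) \<longleftrightarrow> entails sg (D # \<Gamma>) \<Delta>' (u\<up>)"
    if "wk ` \<Delta> \<subseteq> \<Delta>'" "typed sg (D # \<Gamma>) a One" for D \<Delta>' a
  proof -
    have "entails sg (D # \<Gamma>) \<Delta>' (a \<^bold>\<in> P\<up> \<^bold>\<longleftrightarrow> u\<up>)"
      unfolding P_def ren_preimage ren_graph_of_const ren_true_part
      by (rule mem_preimage_true_part) (use that entails_wk[OF adm] in auto)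
    then show ?thesis by (blast intro: iffD1 iffD2)
  qed
  let ?B = "Compr One (u\<up> \<^bold>\<and> p\<up>)"
  have B [intro!]: "typed sg \<Gamma> ?B (Power One)" by auto
  have mem_B: "entails sg (D # \<Gamma>) \<Delta>' (a \<^bold>\<in> ?B\<up>) \<longleftrightarrow>
      entails sg (D # \<Gamma>) \<Delta>' (u\<up>) \<and> entails sg (D # \<Gamma>) \<Delta>' (p\<up>)"
    if "typed sg (D # \<Gamma>) a One" for D \<Delta>' a
    by (simp, subst entails_mem_Compr) (use that in \<open>auto simp: inst_def entails_conj\<close>)
  show ?thesis
  proof (rule subspaceE[OF subsp B])
    show "entails sg \<Gamma> \<Delta> (test_subset T One ?B P)"
      unfolding test_subset_def
    proof (rule entails.conjI)
      show "entails sg \<Gamma> \<Delta> (subset_of One ?B P)"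
      proof (rule subset_ofI)
        fix \<Delta>1 assume \<Delta>1: "wk ` \<Delta> \<subseteq> \<Delta>1" and "entails sg (One # \<Gamma>) \<Delta>1 (Var 0 \<^bold>\<in> ?B\<up>)"
        then have "entails sg (One # \<Gamma>) \<Delta>1 (u\<up>)" by (subst (asm) mem_B) auto
        then show "entails sg (One # \<Gamma>) \<Delta>1 (Var 0 \<^bold>\<in> P\<up>)"
          using \<Delta>1 by (subst mem_P) auto
      qed auto
      show "entails sg \<Gamma> \<Delta> (values_in T One ?B P)"
      proof (rule values_inI)
        fix \<Delta>1 assume \<Delta>1: "wk ` \<Delta> \<subseteq> \<Delta>1" and "entails sg (One # \<Gamma>) \<Delta>1 (Var 0 \<^bold>\<in> P\<up>)"
        then have u1: "entails sg (One # \<Gamma>) \<Delta>1 (u\<up>)"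
          by (subst (asm) mem_P) auto
        have p1: "entails sg (One # \<Gamma>) \<Delta>1 (p\<up> \<^bold>\<in> T\<up>)"
          using entails.implE[OF entails_wk[OF up \<Delta>1, simplified] u1] .
        have "entails sg (One # \<Gamma>) \<Delta>1 (Var 0 \<^bold>\<in> ?B\<up> \<^bold>\<longleftrightarrow> p\<up>)"
        proof (rule iffI')
          fix \<Delta>2 assume "\<Delta>1 \<subseteq> \<Delta>2" "entails sg (One # \<Gamma>) \<Delta>2 (Var 0 \<^bold>\<in> ?B\<up>)"
          then show "entails sg (One # \<Gamma>) \<Delta>2 (p\<up>)"
            by (subst (asm) mem_B) auto
        next
          fix \<Delta>2 assume "\<Delta>1 \<subseteq> \<Delta>2" "entails sg (One # \<Gamma>) \<Delta>2 (p\<up>)"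
          then show "entails sg (One # \<Gamma>) \<Delta>2 (Var 0 \<^bold>\<in> ?B\<up>)"
            using entails_mono[OF u1] by (subst mem_B) auto
        qed auto
        from iff_mem[OF this _ p1]
        show "entails sg (One # \<Gamma>) \<Delta>1 ((Var 0 \<^bold>\<in> ?B\<up>) \<^bold>\<in> T\<up>)" by auto
      qed auto
    qed
  next
    let ?\<Gamma> = "Power One # \<Gamma>"
    \<comment> \<open>The truth value of the extension, which is the variable of index 0.\<close>
    let ?t = "Star \<^bold>\<in> Var 0"
    fix \<Delta>1 assume \<Delta>1: "wk ` \<Delta> \<subseteq> \<Delta>1"
      and C: "entails sg ?\<Gamma> \<Delta>1 (test_subset (T\<up>) One (Var 0) ((Compr One \<^bold>\<top>)\<up>))"
      and eq: "entails sg ?\<Gamma> \<Delta>1 (?B\<up> \<^bold>= intersection One (P\<up>) (Var 0))"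
    have t [intro!]: "typed sg ?\<Gamma> ?t Omega" by auto
    have [intro!]: "typed sg ?\<Gamma> (?B\<up>) (Power One)" using B by (rule typed_wk)
    have "entails sg ?\<Gamma> \<Delta>1 (values_in (T\<up>) One (Var 0) (Compr One \<^bold>\<top>))"
      using C by (simp add: test_subset_def entails_conj)
    from values_inD[OF this, where a = Star]
    have t_test: "entails sg ?\<Gamma> \<Delta>1 (?t \<^bold>\<in> T\<up>)"
      by (auto simp: entails_mem_Compr inst_def intro: entails.truI)
    have B_iff: "entails sg ?\<Gamma> \<Delta>2 (Star \<^bold>\<in> ?B\<up>) \<longleftrightarrow>
        entails sg ?\<Gamma> \<Delta>2 (Star \<^bold>\<in> P\<up>) \<and> entails sg ?\<Gamma> \<Delta>2 ?t" if "\<Delta>1 \<subseteq> \<Delta>2" for \<Delta>2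
    proof -
      have "entails sg ?\<Gamma> \<Delta>2 (Star \<^bold>\<in> ?B\<up>) \<longleftrightarrow>
          entails sg ?\<Gamma> \<Delta>2 (Star \<^bold>\<in> intersection One (P\<up>) (Var 0))"
        by (rule mem_eq[OF entails_mono[OF eq that]]) auto
      also have "\<dots> \<longleftrightarrow> entails sg ?\<Gamma> \<Delta>2 (Star \<^bold>\<in> P\<up>) \<and> entails sg ?\<Gamma> \<Delta>2 ?t"
        by (rule entails_mem_intersection) auto
      finally show ?thesis .
    qed
    have P_iff: "entails sg ?\<Gamma> \<Delta>2 (Star \<^bold>\<in> P\<up>) \<longleftrightarrow> entails sg ?\<Gamma> \<Delta>2 (u\<up>)" if "\<Delta>1 \<subseteq> \<Delta>2" for \<Delta>2
      by (rule mem_P) (use \<Delta>1 that in auto)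
    have B_iff': "entails sg ?\<Gamma> \<Delta>2 (Star \<^bold>\<in> ?B\<up>) \<longleftrightarrow>
        entails sg ?\<Gamma> \<Delta>2 (u\<up>) \<and> entails sg ?\<Gamma> \<Delta>2 (p\<up>)" for \<Delta>2
      by (rule mem_B) simp
    have "entails sg ?\<Gamma> \<Delta>1 (u\<up> \<^bold>\<and> p\<up> \<^bold>\<longleftrightarrow> u\<up> \<^bold>\<and> ?t)"
      by (rule iffI') (use B_iff P_iff B_iff' in \<open>auto simp: entails_conj\<close>)
    then have "entails sg ?\<Gamma> \<Delta>1 (c (u\<up>) (p\<up>) \<^bold>\<longleftrightarrow> c (u\<up>) ?t)" by (rule c_cong)
    moreover have "entails sg ?\<Gamma> \<Delta>1 (c (u\<up>) ?t \<^bold>\<in> T\<up>)"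
      by (rule admissibleD[OF entails_wk[OF adm \<Delta>1, simplified] _ _ _ t_test]) auto
    ultimately have "entails sg ?\<Gamma> \<Delta>1 (c (u\<up>) (p\<up>) \<^bold>\<in> T\<up>)"
      by (rule iff_mem[OF _ typed_wk[OF T]])
    then show "entails sg ?\<Gamma> \<Delta>1 ((c u p \<^bold>\<in> T)\<up>)" by simp
  qed auto
qed

lemma dominant_if_maps_continuous:
  assumes T: "typed sg \<Gamma> T (Power Omega)"
    and cont: "entails sg \<Gamma> \<Delta> (maps_continuous strong T One Omega)"
  shows "entails sg \<Gamma> \<Delta> (dominant T)"
proof (rule dominantI[OF T])
  fix \<Delta>' assume \<Delta>': "wk ` wk ` \<Delta> \<subseteq> \<Delta>'"
    and 1: "entails sg (Omega # Omega # \<Gamma>) \<Delta>' (Var 1 \<^bold>\<in> admissible (T\<up>\<up>))"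
    and 2: "entails sg (Omega # Omega # \<Gamma>) \<Delta>' (Var 1 \<^bold>\<longrightarrow> Var 0 \<^bold>\<in> T\<up>\<up>)"
  show "entails sg (Omega # Omega # \<Gamma>) \<Delta>' (c (Var 1) (Var 0) \<^bold>\<in> T\<up>\<up>)"
    by (rule dominant_instance[OF _ _ _ _ 1 2])
      (use entails_wk[OF entails_wk[OF cont order.refl] \<Delta>'] T in \<open>auto intro!: typed_wk\<close>)
qed

theorem dominant_equivalences:
  assumes T: "typed sg \<Gamma> T (Power Omega)" and \<Delta>: "\<forall>\<phi>\<in>\<Delta>. typed sg \<Gamma> \<phi> Omega"
  shows "(entails sg \<Gamma> \<Delta> (dominant T)
         \<longleftrightarrow> classified sg \<Gamma> \<Delta> strong T (class_values strong T)) \<and>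
      (classified sg \<Gamma> \<Delta> strong T (class_values strong T)
         \<longleftrightarrow> classified_by_some sg \<Gamma> \<Delta> strong T) \<and>
      (classified_by_some sg \<Gamma> \<Delta> strong T \<longleftrightarrow> all_maps_continuous sg \<Gamma> \<Delta> strong T)"
proof -
  have "classified sg \<Gamma> \<Delta> strong T (class_values strong T)" if "entails sg \<Gamma> \<Delta> (dominant T)"
    unfolding classified_def using classified_if_dominant[OF T that] by blast
  moreover have "classified_by_some sg \<Gamma> \<Delta> strong T"
    if "classified sg \<Gamma> \<Delta> strong T (class_values strong T)"
    by (rule classified_by_some_if_classified[OF typed_class_values[OF T] \<Delta>])
      (use that in \<open>simp add: classified_def\<close>)
  moreover have "all_maps_continuous sg \<Gamma> \<Delta> strong T" if "classified_by_some sg \<Gamma> \<Delta> strong T"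
    unfolding all_maps_continuous_def using maps_continuous_if_classified_by_some[OF T that] by blast
  moreover have "entails sg \<Gamma> \<Delta> (dominant T)" if "all_maps_continuous sg \<Gamma> \<Delta> strong T"
    by (rule dominant_if_maps_continuous[OF T]) (use that in \<open>simp add: all_maps_continuous_def\<close>)
  ultimately show ?thesis by blast
qed

end


section \<open>Open and closed truth values\<close>

lemma conj_test_connective:
  fixes sg :: "'c \<Rightarrow> 'b ty"
  shows "test_connective sg Conj"
proof
  fix \<Gamma> :: "'b ty list" and \<Delta> and \<phi> \<psi> :: "('b, 'c) tm"
  assume "typed sg \<Gamma> \<phi> Omega" "typed sg \<Gamma> \<psi> Omega"
  then show "entails sg \<Gamma> \<Delta> (\<phi> \<^bold>\<and> \<phi> \<^bold>\<and> \<psi> \<^bold>\<longleftrightarrow> \<phi> \<^bold>\<and> \<psi>)"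
    by (intro iffI') (auto simp: entails_conj)
qed auto

lemma impl_test_connective:
  fixes sg :: "'c \<Rightarrow> 'b ty"
  shows "test_connective sg Impl"
proof
  fix \<Gamma> :: "'b ty list" and \<Delta> and \<phi> \<psi> :: "('b, 'c) tm"
  assume "typed sg \<Gamma> \<phi> Omega" "typed sg \<Gamma> \<psi> Omega"
  then show "entails sg \<Gamma> \<Delta> (\<phi> \<^bold>\<and> (\<phi> \<^bold>\<longrightarrow> \<psi>) \<^bold>\<longleftrightarrow> \<phi> \<^bold>\<and> \<psi>)"
    by (intro iffI') (auto simp: entails_conj intro: entails.implE implI' entails_mono)
next
  fix \<Gamma> :: "'b ty list" and \<Delta> and \<phi> \<psi> \<psi>' :: "('b, 'c) tm"
  assume eq: "entails sg \<Gamma> \<Delta> (\<phi> \<^bold>\<and> \<psi> \<^bold>\<longleftrightarrow> \<phi> \<^bold>\<and> \<psi>')"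
  have [simp]: "typed sg \<Gamma> \<phi> Omega" "typed sg \<Gamma> \<psi> Omega" "typed sg \<Gamma> \<psi>' Omega"
    using entails_typed[OF eq] by auto
  have iff: "entails sg \<Gamma> \<Delta>' \<psi> \<longleftrightarrow> entails sg \<Gamma> \<Delta>' \<psi>'"
    if "\<Delta> \<subseteq> \<Delta>'" "entails sg \<Gamma> \<Delta>' \<phi>" for \<Delta>'
    using iffD1[OF entails_mono[OF eq that(1)]] iffD2[OF entails_mono[OF eq that(1)]] that(2)
    by (auto simp: entails_conj)
  show "entails sg \<Gamma> \<Delta> ((\<phi> \<^bold>\<longrightarrow> \<psi>) \<^bold>\<longleftrightarrow> (\<phi> \<^bold>\<longrightarrow> \<psi>'))"
  proof (rule iffI')
    fix \<Delta>1 assume \<Delta>1: "\<Delta> \<subseteq> \<Delta>1" and *: "entails sg \<Gamma> \<Delta>1 (\<phi> \<^bold>\<longrightarrow> \<psi>)"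
    show "entails sg \<Gamma> \<Delta>1 (\<phi> \<^bold>\<longrightarrow> \<psi>')"
    proof (rule implI')
      fix \<Delta>2 assume "\<Delta>1 \<subseteq> \<Delta>2" "entails sg \<Gamma> \<Delta>2 \<phi>"
      then show "entails sg \<Gamma> \<Delta>2 \<psi>'"
        using entails.implE[OF entails_mono[OF *]] iff[of \<Delta>2] \<Delta>1 by auto
    qed simp
  next
    fix \<Delta>1 assume \<Delta>1: "\<Delta> \<subseteq> \<Delta>1" and *: "entails sg \<Gamma> \<Delta>1 (\<phi> \<^bold>\<longrightarrow> \<psi>')"
    show "entails sg \<Gamma> \<Delta>1 (\<phi> \<^bold>\<longrightarrow> \<psi>)"
    proof (rule implI')
      fix \<Delta>2 assume "\<Delta>1 \<subseteq> \<Delta>2" "entails sg \<Gamma> \<Delta>2 \<phi>"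
      then show "entails sg \<Gamma> \<Delta>2 \<psi>"
        using entails.implE[OF entails_mono[OF *]] iff[of \<Delta>2] \<Delta>1 by auto
    qed simp
  qed auto
qed auto

theorem proposition2p52:
  fixes sg :: "'c \<Rightarrow> 'b ty"
    and \<Gamma> :: "'b ty list"
    and \<Delta> :: "('b, 'c) tm set"
    and T :: "('b, 'c) tm"
  assumes "typed sg \<Gamma> T (Power Omega)"
    and "\<forall>\<phi>\<in>\<Delta>. typed sg \<Gamma> \<phi> Omega"
  shows
    "((entails sg \<Gamma> \<Delta> (dominance T)
         \<longleftrightarrow> classified sg \<Gamma> \<Delta> strongly_open T (class_values strongly_open T)) \<and>
      (classified sg \<Gamma> \<Delta> strongly_open T (class_values strongly_open T)
         \<longleftrightarrow> classified_by_some sg \<Gamma> \<Delta> strongly_open T) \<and>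
      (classified_by_some sg \<Gamma> \<Delta> strongly_open T
         \<longleftrightarrow> all_maps_continuous sg \<Gamma> \<Delta> strongly_open T)) \<and>
     ((entails sg \<Gamma> \<Delta> (codominance T)
         \<longleftrightarrow> classified sg \<Gamma> \<Delta> strongly_closed T (class_values strongly_closed T)) \<and>
      (classified sg \<Gamma> \<Delta> strongly_closed T (class_values strongly_closed T)
         \<longleftrightarrow> classified_by_some sg \<Gamma> \<Delta> strongly_closed T) \<and>
      (classified_by_some sg \<Gamma> \<Delta> strongly_closed T
         \<longleftrightarrow> all_maps_continuous sg \<Gamma> \<Delta> strongly_closed T))"
proof -
  interpret opn: test_connective sg Conj by (rule conj_test_connective)
  interpret cls: test_connective sg Impl by (rule impl_test_connective)
  have "opn.admissible = opens" "cls.admissible = closeds"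
    by (simp_all add: fun_eq_iff opn.admissible_def cls.admissible_def opens_def closeds_def)
  then have "opn.strong = strongly_open" "opn.dominant = dominance"
    "cls.strong = strongly_closed" "cls.dominant = codominance"
    by (simp_all add: fun_eq_iff opn.strong_def cls.strong_def opn.dominant_def cls.dominant_def
        strongly_open_def open_subset_def strongly_closed_def closed_subset_def
        dominance_def codominance_def)
  then show ?thesis
    using opn.dominant_equivalences[OF assms] cls.dominant_equivalences[OF assms] by simp
qed

end
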